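(* Let $\mathcal{R}\subseteq\mathbb{R}^2$ be the set of all $(r_0,r_1)\in\mathbb{R}^2$ that belong to none of the following sets: (1) $\{-2<r_0+r_1<0\}$; (2) $\{r_1=r_0+1\}$; (3) $\{-2<r_0\le -1,\ -1<r_1\le 0\}$; (4) $\{-1\le r_0<0,\ 0\le r_1<1\}$; (5) $\{r_0>0,\ r_1\le -2\sqrt{r_0},\ r_0+r_1\ge 0\}$; (6) $\{r_0+r_1\le -2,\ r_0-r_1\ne -1\}\setminus\{r_0>-2,\ r_1>-1\}$; (7) $\{r_0+r_1\ge 0,\ r_0<0,\ r_1\ge 1\}$; (8) $\{r_0-r_1<-1,\ r_0\ge 0\}$; (9) $\{r_0-r_1>-\tfrac12,\ r_1\ge\max\{-2\sqrt{r_0},-r_0\},\ r_0>\tfrac32+\sqrt2\}$; (10) $\{-1<r_0-r_1\le-\tfrac12,\ r_1\ge 1+\sqrt5,\ r_1^2\ge 4r_0\}$. Then $\mathcal{R}\cap\{(x,y)\in\mathbb{R}^2\mid x\ge \tfrac43\}\subset\mathcal{D}_2^{( * )}$.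
   Context: For $\mathbf{r}=(r_0,r_1)\in\mathbb{R}^2$, the two-dimensional shift radix system is the map $\tau_{\mathbf{r}}:\mathbb{Z}^2\to\mathbb{Z}^2$, $\tau_{\mathbf{r}}(a_0,a_1)=(a_1,-\lfloor r_0a_0+r_1a_1\rfloor)$. The orbit of $(a_0,a_1)$ is identified with the integer sequence $(a_n)_{n\ge 0}$ where $a_{n+2}=-\lfloor r_0a_n+r_1a_{n+1}\rfloor$ for $n\ge0$. An orbit is ultimately periodic if there are $n_0\ge 0$, $p>0$ with $a_{n+p}=a_n$ for all $n\ge n_0$; it ends up in the trivial cycle if $a_n=0$ for all sufficiently large $n$. $\mathcal{D}_2^{( * )}$ is the set of all $\mathbf{r}\in\mathbb{R}^2$ such that each ultimately periodic orbit of $\tau_{\mathbf{r}}$ ends up in the trivial cycle. In the definition of $\mathcal{R}$ each listed set is a set of points $(r_0,r_1)\in\mathbb{R}^2$. *)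

theory Defs
  imports Complex_Main
begin

definition srs :: "real \<times> real \<Rightarrow> int \<times> int \<Rightarrow> int \<times> int" where
  "srs r a = (snd a, - \<lfloor>fst r * of_int (fst a) + snd r * of_int (snd a)\<rfloor>)"

(* The sequence of first components determines the orbit: see srs_iterate_eq below. *)
definition srs_orbit :: "real \<times> real \<Rightarrow> int \<times> int \<Rightarrow> nat \<Rightarrow> int" where
  "srs_orbit r a n = fst ((srs r ^^ n) a)"

lemma srs_orbit_0: "srs_orbit r a 0 = fst a"
  by (simp add: srs_orbit_def)

lemma srs_orbit_1: "srs_orbit r a (Suc 0) = snd a"
  by (simp add: srs_orbit_def srs_def)

lemma srs_orbit_rec:
  "srs_orbit r a (n + 2) =
     - \<lfloor>fst r * of_int (srs_orbit r a n) + snd r * of_int (srs_orbit r a (n + 1))\<rfloor>"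
  by (simp add: srs_orbit_def srs_def)

lemma srs_iterate_eq: "(srs r ^^ n) a = (srs_orbit r a n, srs_orbit r a (Suc n))"
  by (simp add: srs_orbit_def srs_def)

definition ultimately_periodic :: "(nat \<Rightarrow> int) \<Rightarrow> bool" where
  "ultimately_periodic s \<longleftrightarrow> (\<exists>n0. \<exists>p>0. \<forall>n\<ge>n0. s (n + p) = s n)"

definition ends_in_trivial_cycle :: "(nat \<Rightarrow> int) \<Rightarrow> bool" where
  "ends_in_trivial_cycle s \<longleftrightarrow> (\<exists>n0. \<forall>n\<ge>n0. s n = 0)"

definition D2star :: "(real \<times> real) set" where
  "D2star = {r. \<forall>a. ultimately_periodic (srs_orbit r a) \<longrightarrow> ends_in_trivial_cycle (srs_orbit r a)}"

definition region_R :: "(real \<times> real) set" where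
  "region_R = - (
       {(r0, r1). -2 < r0 + r1 \<and> r0 + r1 < 0}
     \<union> {(r0, r1). r1 = r0 + 1}
     \<union> {(r0, r1). -2 < r0 \<and> r0 \<le> -1 \<and> -1 < r1 \<and> r1 \<le> 0}
     \<union> {(r0, r1). -1 \<le> r0 \<and> r0 < 0 \<and> 0 \<le> r1 \<and> r1 < 1}
     \<union> {(r0, r1). r0 > 0 \<and> r1 \<le> -2 * sqrt r0 \<and> r0 + r1 \<ge> 0}
     \<union> ({(r0, r1). r0 + r1 \<le> -2 \<and> r0 - r1 \<noteq> -1} - {(r0, r1). r0 > -2 \<and> r1 > -1})
     \<union> {(r0, r1). r0 + r1 \<ge> 0 \<and> r0 < 0 \<and> r1 \<ge> 1}
     \<union> {(r0, r1). r0 - r1 < -1 \<and> r0 \<ge> 0}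
     \<union> {(r0, r1). r0 - r1 > -1/2 \<and> r1 \<ge> max (-2 * sqrt r0) (- r0) \<and> r0 > 3/2 + sqrt 2}
     \<union> {(r0, r1). -1 < r0 - r1 \<and> r0 - r1 \<le> -1/2 \<and> r1 \<ge> 1 + sqrt 5 \<and> r1\<^sup>2 \<ge> 4 * r0})"

end

theory Submission
  imports Defs
begin

text \<open>
  Fix a parameter \<open>(x, y)\<close> and write \<open>\<delta> = x + 1 - y > 0\<close>. An ultimately periodic orbit yields a
  periodic sequence \<open>a\<close> on the integers with \<open>0 \<le> x a\<^sub>i + y a\<^sub>i\<^sub>+\<^sub>1 + a\<^sub>i\<^sub>+\<^sub>2 < 1\<close>, and it must be shown that
  \<open>a = 0\<close>. The characteristic roots lie outside the unit circle, so such a sequence is bounded in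
  terms of \<open>(x, y)\<close>; the bound degenerates only as \<open>\<delta> \<rightarrow> 0\<close>, where one root tends to \<open>-1\<close>.

  For \<open>\<delta> < 1/11\<close> put \<open>A\<^sub>i = (-1)\<^sup>i a\<^sub>i\<close> and \<open>B\<^sub>i = A\<^sub>i - A\<^sub>i\<^sub>+\<^sub>1\<close>. Then \<open>B\<^sub>i\<^sub>+\<^sub>1\<close> is alternately the floor and the
  ceiling of \<open>x B\<^sub>i + \<delta> A\<^sub>i\<^sub>+\<^sub>1\<close>. The analytic bound gives \<open>\<delta> \<bar>A\<^sub>i\<bar> \<le> 4 (x - 1)\<close>, so \<open>B \<ge> 4\<close> would persist forever,
  which periodicity forbids; and \<open>B \<ge> 0\<close> while \<open>A > 0\<close> is driven up to \<open>B \<ge> 4\<close> by the rounding. Hence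
  \<open>A\<close> strictly increases up to every positive value, contradicting periodicity at the maximum of \<open>A\<close>.

  For \<open>\<delta> \<ge> 1/11\<close> the analytic bounds give \<open>K = max \<bar>a\<^sub>i\<bar> \<le> 12\<close>, and a finite search around an entry of
  absolute value \<open>K\<close> rules out each \<open>K \<ge> 1\<close>: a word of consecutive entries confines \<open>(x, y)\<close> to a convex
  polygon, and every extension of the word eventually makes this polygon empty or exceeds \<open>K\<close>.
\<close>

section \<open>A certificate checker for the finite search\<close>

type_synonym halfplane = "int \<times> int \<times> int \<times> bool"

fun holds :: "real \<Rightarrow> real \<Rightarrow> halfplane \<Rightarrow> bool" where
  "holds x y (a, b, c, strict) \<longleftrightarrow>
     (if strict then 0 < a * x + b * y + c else 0 \<le> a * x + b * y + c)"

text \<open>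
  The multipliers \<open>l1, l2, l3\<close> are the \<open>2 \<times> 2\<close> minors of the normal vectors, which make the combination
  of the three linear forms constant.
\<close>

fun incompatible :: "halfplane \<Rightarrow> halfplane \<Rightarrow> halfplane \<Rightarrow> bool" where
  "incompatible (a1, b1, c1, s1) (a2, b2, c2, s2) (a3, b3, c3, s3) \<longleftrightarrow>
     (let l1 = a2 * b3 - b2 * a3; l2 = a3 * b1 - b3 * a1; l3 = a1 * b2 - b1 * a2;
          v = l1 * c1 + l2 * c2 + l3 * c3
      in 0 \<le> l1 \<and> 0 \<le> l2 \<and> 0 \<le> l3 \<and>
         (v < 0 \<or> v = 0 \<and> (0 < l1 \<and> s1 \<or> 0 < l2 \<and> s2 \<or> 0 < l3 \<and> s3)))"

lemma incompatible_sound: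
  assumes "incompatible g1 g2 g3" "holds x y g1" "holds x y g2" "holds x y g3"
  shows False
proof -
  obtain a1 b1 c1 s1 where g1: "g1 = (a1, b1, c1, s1)" by (cases g1)
  obtain a2 b2 c2 s2 where g2: "g2 = (a2, b2, c2, s2)" by (cases g2)
  obtain a3 b3 c3 s3 where g3: "g3 = (a3, b3, c3, s3)" by (cases g3)
  define l1 l2 l3 where "l1 = a2 * b3 - b2 * a3" and "l2 = a3 * b1 - b3 * a1" and "l3 = a1 * b2 - b1 * a2"
  define v where "v = l1 * c1 + l2 * c2 + l3 * c3"
  define e1 e2 e3 where "e1 = a1 * x + b1 * y + c1" and "e2 = a2 * x + b2 * y + c2"
    and "e3 = a3 * x + b3 * y + c3"
  have l: "0 \<le> l1" "0 \<le> l2" "0 \<le> l3"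
    and v: "v < 0 \<or> v = 0 \<and> (0 < l1 \<and> s1 \<or> 0 < l2 \<and> s2 \<or> 0 < l3 \<and> s3)"
    using assms(1) unfolding g1 g2 g3 incompatible.simps Let_def v_def l1_def l2_def l3_def by auto
  have e: "0 \<le> e1" "0 \<le> e2" "0 \<le> e3" "s1 \<Longrightarrow> 0 < e1" "s2 \<Longrightarrow> 0 < e2" "s3 \<Longrightarrow> 0 < e3"
    using assms(2-4) unfolding g1 g2 g3 holds.simps e1_def e2_def e3_def by (auto split: if_splits)
  have sum: "l1 * e1 + l2 * e2 + l3 * e3 = v"
    unfolding e1_def e2_def e3_def v_def l1_def l2_def l3_def by (simp add: algebra_simps)
  have nn: "0 \<le> l1 * e1" "0 \<le> l2 * e2" "0 \<le> l3 * e3" using l e by auto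
  have "\<not> v < 0" using sum nn by linarith
  then have s: "0 < l1 \<and> s1 \<or> 0 < l2 \<and> s2 \<or> 0 < l3 \<and> s3" and "v = 0" using v by auto
  then have "real_of_int l1 * e1 = 0" "real_of_int l2 * e2 = 0" "real_of_int l3 * e3 = 0"
    using sum nn by linarith+
  moreover have "0 < real_of_int l1 * e1 \<or> 0 < real_of_int l2 * e2 \<or> 0 < real_of_int l3 * e3"
    using s e(4-6) by auto
  ultimately show False by linarith
qed

text \<open>By Helly's theorem, an empty intersection of finitely many half-planes is witnessed by
  three of them, and \<open>g\<close> is one of these if the conditions in \<open>cs\<close> are
  still compatible. The order of \<open>i\<close> and \<open>j\<close> fixes the orientation that
  makes the minors nonnegative. Equal indices never refute, since nonnegative minors then all
  vanish; certificates carry \<open>0 0\<close> where the bound \<open>K\<close> alone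
  decides.\<close>

definition refutes :: "halfplane \<Rightarrow> halfplane list \<Rightarrow> nat \<Rightarrow> nat \<Rightarrow> bool" where
  "refutes g cs i j \<longleftrightarrow>
     i < length cs \<and> j < length cs \<and> incompatible g (cs ! i) (cs ! j)"

lemma refutes_sound:
  assumes "refutes g cs i j" "holds x y g" "list_all (holds x y) cs"
  shows False
  using assms incompatible_sound[of g "cs ! i" "cs ! j" x y] by (simp add: refutes_def list_all_length)

text \<open>
  A certificate extends a word of consecutive entries, beginning with \<open>p, q\<close> and ending with \<open>r, s\<close>,
  by one entry on the right (\<open>Fwd\<close>) or on the left (\<open>Bwd\<close>). The list contains a certificate for each of
  the values \<open>lo, lo + 1, \<dots>\<close> of the new entry. Smaller and larger values are excluded by the
  bound \<open>K\<close> or by the conditions with indices \<open>i, j\<close> and \<open>k, l\<close>, respectively, in the list \<open>cs\<close> of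
  half-planes known to contain \<open>(x, y)\<close>, which grows by two at the front with each new entry.
\<close>

datatype cert =
    Fwd int nat nat nat nat "cert list"
  | Bwd int nat nat nat nat "cert list"

fun check forward backward where
  "check K cs p q r s (Fwd lo i j k l ts) \<longleftrightarrow>
     (lo \<le> - K \<or> refutes (r, s, lo - 1, False) cs i j) \<and> forward K cs p q r s lo k l ts"
| "check K cs p q r s (Bwd lo i j k l ts) \<longleftrightarrow>
     (lo \<le> - K \<or> refutes (lo - 1, p, q, False) cs i j) \<and> backward K cs p q r s lo k l ts"
| "forward K cs p q r s c k l [] \<longleftrightarrow> K < c \<or> refutes (- r, - s, 1 - c, True) cs k l"
| "forward K cs p q r s c k l (t # ts) \<longleftrightarrow>
     check K ((r, s, c, False) # (- r, - s, 1 - c, True) # cs) p q s c t \<and>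
     forward K cs p q r s (c + 1) k l ts"
| "backward K cs p q r s c k l [] \<longleftrightarrow> K < c \<or> refutes (- c, - p, 1 - q, True) cs k l"
| "backward K cs p q r s c k l (t # ts) \<longleftrightarrow>
     check K ((c, p, q, False) # (- c, - p, 1 - q, True) # cs) c p r s t \<and>
     backward K cs p q r s (c + 1) k l ts"

text \<open>Integer indices give every entry a predecessor, so that words can also be extended to
  the left. The two inequalities are the floor recursion of the orbit.\<close>

definition srs_cycle :: "real \<Rightarrow> real \<Rightarrow> (int \<Rightarrow> int) \<Rightarrow> bool" where
  "srs_cycle x y a \<longleftrightarrow>
     (\<exists>p>0. \<forall>i. a (i + p) = a i) \<and>
     (\<forall>i. 0 \<le> x * a i + y * a (i + 1) + a (i + 2) \<and> x * a i + y * a (i + 1) + a (i + 2) < 1)"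

lemma srs_cycle_bounds:
  assumes "srs_cycle x y a"
  shows "0 \<le> a i * x + a (i + 1) * y + a (i + 2)" "a i * x + a (i + 1) * y + a (i + 2) < 1"
    and "0 \<le> a (i - 1) * x + a i * y + a (i + 1)" "a (i - 1) * x + a i * y + a (i + 1) < 1"
proof -
  have *: "0 \<le> a j * x + a (j + 1) * y + a (j + 2) \<and> a j * x + a (j + 1) * y + a (j + 2) < 1" for j
    using assms by (simp add: srs_cycle_def mult.commute)
  show "0 \<le> a i * x + a (i + 1) * y + a (i + 2)" "a i * x + a (i + 1) * y + a (i + 2) < 1"
    using *[of i] by auto
  have "i - 1 + 2 = i + 1" by simp
  then show "0 \<le> a (i - 1) * x + a i * y + a (i + 1)" "a (i - 1) * x + a i * y + a (i + 1) < 1"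
    using *[of "i - 1"] by (simp_all only: diff_add_cancel)
qed

text \<open>The actual sequence is followed through the certificate. All values below
  \<open>lo\<close> are refuted at once, because the lower inequality for such a value implies the
  one for \<open>lo - 1\<close>; likewise the upper inequality for the first value not listed covers
  all larger ones. In the branch of the actual entry the two new half-planes again contain
  \<open>(x, y)\<close>.\<close>

lemma check_sound:
  assumes "srs_cycle x y a" "0 \<le> x" "\<And>i. \<bar>a i\<bar> \<le> K"
  shows "check K cs p q r s t \<Longrightarrow> list_all (holds x y) cs \<Longrightarrow> a m = p \<Longrightarrow> a (m + 1) = q \<Longrightarrow>
      a n = r \<Longrightarrow> a (n + 1) = s \<Longrightarrow> False"
    and "forward K cs p q r s c k l ts \<Longrightarrow> list_all (holds x y) cs \<Longrightarrow> a m = p \<Longrightarrow> a (m + 1) = q \<Longrightarrow>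
      a n = r \<Longrightarrow> a (n + 1) = s \<Longrightarrow> c \<le> a (n + 2) \<Longrightarrow> False"
    and "backward K cs p q r s c k l ts \<Longrightarrow> list_all (holds x y) cs \<Longrightarrow> a m = p \<Longrightarrow> a (m + 1) = q \<Longrightarrow>
      a n = r \<Longrightarrow> a (n + 1) = s \<Longrightarrow> c \<le> a (m - 1) \<Longrightarrow> False"
proof (induction K\<equiv>K cs p q r s t and K\<equiv>K cs p q r s c k l ts and K\<equiv>K cs p q r s c k l ts
    arbitrary: m n and m n and m n rule: check_forward_backward.induct)
  case (1 cs p q r s lo i j k l ts)
  have rec: "0 \<le> r * x + s * y + a (n + 2)"
    using srs_cycle_bounds(1)[OF assms(1), of n] 1 by simp
  have "lo \<le> a (n + 2)"
  proof (rule ccontr)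
    assume "\<not> lo \<le> a (n + 2)"
    then have "real_of_int (a (n + 2)) \<le> lo - 1" by linarith
    then have "holds x y (r, s, lo - 1, False)" using rec by simp
    moreover have "\<not> lo \<le> - K" using \<open>\<not> lo \<le> a (n + 2)\<close> assms(3)[of "n + 2"] by linarith
    then have "refutes (r, s, lo - 1, False) cs i j" using 1(2) by simp
    ultimately show False using 1(3) refutes_sound by blast
  qed
  then show ?case using 1 by auto
next
  case (2 cs p q r s lo i j k l ts)
  have "0 \<le> a (m - 1) * x + p * y + q"
    using srs_cycle_bounds(3)[OF assms(1), of m] 2(4,5) by simp
  \<comment> \<open>The unknown left entry is the coefficient of \<open>x\<close>, so the
    monotonicity rests on \<open>0 \<le> x\<close>.\<close>
  then have rec: "a (m - 1) \<le> lo - 1 \<Longrightarrow> 0 \<le> (lo - 1) * x + p * y + q"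
    using assms(2) mult_right_mono[of "real_of_int (a (m - 1))" "lo - 1" x] by auto
  have "lo \<le> a (m - 1)"
  proof (rule ccontr)
    assume less: "\<not> lo \<le> a (m - 1)"
    then have "holds x y (lo - 1, p, q, False)" using rec by simp
    moreover have "\<not> lo \<le> - K" using less assms(3)[of "m - 1"] by linarith
    then have "refutes (lo - 1, p, q, False) cs i j" using 2(2) by simp
    ultimately show False using 2(3) refutes_sound by blast
  qed
  then show ?case using 2 by auto
next
  case (3 cs p q r s c k l)
  have "r * x + s * y + a (n + 2) < 1"
    using srs_cycle_bounds(2)[OF assms(1), of n] 3 by simp
  moreover have "real_of_int c \<le> a (n + 2)" using 3 by simp
  ultimately have "holds x y (- r, - s, 1 - c, True)" by simp
  moreover have "\<not> K < c" using 3 assms(3)[of "n + 2"] by linarith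
  then have "refutes (- r, - s, 1 - c, True) cs k l" using 3(1) by simp
  ultimately show ?case using 3(2) refutes_sound by blast
next
  case (4 cs p q r s c k l t ts)
  show ?case
  proof (cases "a (n + 2) = c")
    case True
    have "0 \<le> r * x + s * y + c" "r * x + s * y + c < 1"
      using srs_cycle_bounds(1,2)[OF assms(1), of n] 4(7,8) True by simp_all
    then show False using 4(1)[of m "n + 1"] 4(3-) True by (simp add: add.assoc)
  next
    case False
    then show False using 4(2)[of m n] 4(3-) by simp
  qed
next
  case (5 cs p q r s c k l)
  have "a (m - 1) * x + p * y + q < 1"
    using srs_cycle_bounds(4)[OF assms(1), of m] 5(3,4) by simp
  moreover have "c * x \<le> a (m - 1) * x" using 5 assms(2) by (intro mult_right_mono) auto
  ultimately have "holds x y (- c, - p, 1 - q, True)" by simp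
  moreover have "\<not> K < c" using 5 assms(3)[of "m - 1"] by linarith
  then have "refutes (- c, - p, 1 - q, True) cs k l" using 5(1) by simp
  ultimately show ?case using 5(2) refutes_sound by blast
next
  case (6 cs p q r s c k l t ts)
  show ?case
  proof (cases "a (m - 1) = c")
    case True
    have "0 \<le> c * x + p * y + q" "c * x + p * y + q < 1"
      using srs_cycle_bounds(3,4)[OF assms(1), of m] 6(5,6) True by simp_all
    then show False using 6(1)[of "m - 1" n] 6(3-) True by simp
  next
    case False
    then show False using 6(2)[of m n] 6(3-) by simp
  qed
qed

text \<open>The initial word consists of \<open>s\<close> and its successor \<open>b\<close>. It is
  both the left and the right end of itself, hence the repetition of \<open>s b\<close>.\<close>

definition check_roots :: "int \<Rightarrow> halfplane list \<Rightarrow> int \<Rightarrow> cert list \<Rightarrow> bool" where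
  "check_roots K cs s ts \<longleftrightarrow> list_all2 (\<lambda>b. check K cs s b s b) [- K..K] ts"

lemma check_roots_sound:
  assumes "check_roots K cs s ts" "srs_cycle x y a" "0 \<le> x" "\<And>i. \<bar>a i\<bar> \<le> K"
    and "list_all (holds x y) cs"
  shows "a i \<noteq> s"
proof
  assume "a i = s"
  have "a (i + 1) \<in> set [- K..K]" using assms(4)[of "i + 1"] by auto
  then obtain t where "check K cs s (a (i + 1)) s (a (i + 1)) t"
    using assms(1) unfolding check_roots_def list_all2_conv_all_nth in_set_conv_nth by metis
  then show False using check_sound(1)[OF assms(2-4) _ assms(5)] \<open>a i = s\<close> by blast
qed

section \<open>The search for \<open>\<delta> \<ge> 1/11\<close>\<close>

text \<open>
  \<open>4/3 \<le> x \<le> 3\<close>, \<open>0 \<le> x + y\<close> and \<open>\<delta> \<ge> 1/11\<close>, together with \<open>\<delta> \<le> 3/4\<close> if \<open>K \<ge> 4\<close> and \<open>\<delta> \<le> 8/25\<close> if \<open>K \<ge> 6\<close>.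
\<close>

definition walls :: "int \<Rightarrow> halfplane list" where
  "walls K =
     [(3, 0, - 4, False), (- 1, 0, 3, False), (1, 1, 0, False), (11, - 11, 10, False)] @
     (if K < 4 then [] else if K < 6 then [(- 4, 4, - 1, False)] else [(- 25, 25, - 17, False)])"

text \<open>The certificates were found by a depth-first search with exact polygon clipping.\<close>

lemma check_roots_1:
  "check_roots 1 (walls 1) 1
     [Bwd 0 3 0 0 0 [Bwd 0 2 0 2 0 [], Fwd (-1) 0 0 1 2 [Fwd 1 0 2 0 0 [Fwd 2 0 6 0 0 []], Fwd 2 0 4 0 0 []]],
      Bwd (-1) 0 0 0 0 [Fwd (-1) 0 0 2 0 [Fwd 2 4 2 0 0 []], Bwd 0 2 0 2 0 [], Bwd 0 1 2 2 0 [Bwd 0 4 0 2 0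
      []]], Bwd (-1) 0 0 0 2 [Fwd (-1) 0 0 2 0 [Fwd (-1) 0 0 3 0 [Fwd 2 6 4 0 0 [], Fwd 2 0 6 0 0 []]], Bwd 0
      2 0 2 0 []]]"
  "check_roots 1 (walls 1) (- 1)
     [Fwd 0 0 2 0 0 [Fwd 2 0 2 0 0 [], Fwd 2 0 2 0 0 []], Fwd 2 0 2 0 0 [], Fwd 0 3 0 0 0 [Fwd (-1) 0 0 2 0
      [Fwd 2 4 2 0 0 []], Fwd (-1) 0 0 2 0 [Fwd (-1) 0 0 3 0 [Fwd 2 6 4 0 0 [], Fwd 2 0 6 0 0 []]]]]"
  by code_simp+

lemma check_roots_2:
  "check_roots 2 (walls 2) 2
     [Fwd (-2) 0 0 0 0 [Fwd 3 2 1 0 0 [], Fwd 3 2 1 0 0 [], Fwd 3 0 2 0 0 [], Fwd 1 0 2 0 0 [Fwd (-2) 0 0 4 0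
      [], Fwd (-2) 0 0 1 3 []], Fwd (-1) 5 2 2 1 [Bwd (-1) 1 4 4 0 [Bwd 0 6 0 3 0 [Fwd 0 7 0 0 8 [Fwd 2 0 10 0
      0 [Fwd (-2) 0 0 1 6 []]]]]]], Fwd (-2) 0 0 3 0 [Fwd 1 2 1 0 0 [Fwd 3 0 4 0 0 [], Fwd 2 0 2 0 0 [Fwd (-2)
      0 0 6 0 []]], Fwd 3 2 1 0 0 [], Fwd 2 0 2 0 0 [Fwd (-2) 0 0 4 3 []]], Fwd (-2) 0 0 0 2 [Fwd (-2) 0 0 0 0
      [Fwd 0 2 1 3 0 [Fwd 3 0 6 0 0 [], Fwd 3 2 1 0 0 []], Fwd 2 2 1 0 0 [Fwd 3 0 6 0 0 []], Fwd 3 0 4 0 0 [],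
      Fwd 3 0 4 0 0 [], Fwd 1 0 4 0 0 [Fwd (-2) 0 0 6 0 [], Fwd (-2) 0 0 1 3 []]]], Bwd (-2) 0 0 0 2 [Fwd (-2)
      0 0 2 0 [], Fwd (-2) 0 0 2 0 [Fwd (-1) 0 2 3 0 [Fwd 3 6 1 0 0 [], Fwd 3 0 6 0 0 []]], Fwd (-2) 0 0 2 0
      [Bwd (-1) 3 0 0 2 [Bwd 0 1 4 5 1 [Bwd 1 2 0 0 3 [Bwd 1 9 0 0 3 [Bwd 0 1 2 2 0 [Bwd 0 9 0 2 0 []]]]]]],
      Bwd 0 1 2 2 0 [Bwd 0 1 2 2 0 []]], Fwd (-2) 0 0 0 2 [Fwd (-2) 0 0 1 2 [Fwd 3 4 1 0 0 []], Fwd (-2) 0 0 1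
      2 [], Fwd (-2) 0 0 2 0 [Bwd 0 3 0 0 2 [Bwd (-1) 6 0 2 0 [Bwd 0 1 2 3 1 [Fwd (-1) 1 2 2 5 [Fwd 2 5 1 0 0
      [Fwd 3 2 7 0 0 []]]]], Bwd 0 1 2 2 0 [Bwd 0 1 6 2 0 []]]]]]"
  "check_roots 2 (walls 2) (- 2)
     [Fwd 0 0 2 0 0 [Fwd 3 0 2 0 0 [], Fwd 3 0 2 0 0 [], Fwd 3 0 2 0 0 []], Fwd 2 0 2 0 0 [Fwd 3 0 2 0 0 []],
      Fwd 3 0 2 0 0 [], Fwd 1 3 0 0 0 [Fwd (-2) 0 0 2 0 [], Fwd (-2) 0 0 2 0 [Fwd (-1) 0 2 1 4 [Fwd 3 0 2 0 0
      []]]], Fwd (-1) 3 0 0 0 [Bwd 2 2 0 0 0 [Bwd (-1) 3 4 4 1 [Bwd 0 6 0 2 0 [Fwd 0 5 0 0 8 [Fwd 2 0 10 0 0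
      [Fwd (-2) 0 0 1 6 []]]]]], Fwd (-2) 0 0 2 0 [Fwd 3 4 2 0 0 []], Fwd (-2) 0 0 2 0 [], Fwd (-2) 0 0 2 0
      []]]"
  by code_simp+

lemma check_roots_3:
  "check_roots 3 (walls 3) 3
     [Fwd (-3) 0 0 0 0 [Fwd 4 2 1 0 0 [], Fwd 4 2 1 0 0 [], Fwd 4 2 1 0 0 [], Fwd 4 0 2 0 0 [], Fwd 3 0 2 0 0
      [Fwd (-3) 0 0 1 3 []], Bwd (-2) 0 2 2 1 [Bwd 1 2 0 2 0 [Bwd 0 3 1 6 1 [Bwd 0 5 0 2 0 []]], Bwd 0 4 3 3 1
      []], Fwd (-2) 5 2 2 1 [Bwd (-2) 1 4 4 0 [Bwd 1 6 0 3 0 [Bwd 0 3 1 8 1 [Bwd 0 5 0 2 0 []]]]]], Fwd (-3) 0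
      0 3 0 [Fwd 3 2 1 0 0 [Fwd 4 0 4 0 0 []], Fwd 4 2 1 0 0 [], Fwd 4 2 1 0 0 [], Fwd 3 0 2 0 0 [Fwd (-3) 0 0
      4 3 []], Fwd 1 0 2 1 5 [Fwd (-3) 0 0 4 0 [Fwd 4 0 2 0 0 []]]], Fwd (-3) 0 0 3 0 [Fwd 2 2 1 0 0 [Fwd 4 0
      4 0 0 [], Fwd 3 0 4 0 0 [Fwd (-3) 0 0 1 3 []]], Fwd 4 2 1 0 0 [], Fwd 4 2 1 0 0 []], Fwd (-3) 0 0 0 2
      [], Fwd (-3) 0 0 0 2 [Fwd (-3) 0 0 1 2 [Fwd 2 2 1 0 0 [Fwd 4 2 1 0 0 [], Fwd 4 2 1 0 0 []], Fwd 3 2 1 0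
      0 [Fwd 4 2 4 0 0 []], Fwd 4 4 1 0 0 []], Fwd (-3) 0 0 1 2 [Bwd 2 3 0 4 1 [Bwd 0 1 6 0 3 [Bwd (-1) 1 2 2
      0 [Bwd 0 1 4 0 3 []]]]]], Fwd (-3) 0 0 0 2 [Fwd (-3) 0 0 1 2 [Fwd 3 2 1 0 0 [Fwd 4 2 1 0 0 []], Fwd 4 4
      1 0 0 []], Fwd (-3) 0 0 1 2 [Fwd 1 2 1 3 0 [Fwd 4 2 1 0 0 [], Fwd 4 2 1 0 0 []]], Fwd (-3) 0 0 1 2 [Fwd
      (-2) 2 1 3 0 [Fwd 2 6 1 3 0 [Fwd 4 2 1 0 0 []], Fwd 3 2 1 0 0 [Fwd 4 2 4 0 0 []]]]], Fwd (-3) 0 0 0 2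
      [Fwd (-3) 0 0 1 2 [], Fwd (-3) 0 0 1 2 [], Fwd (-3) 0 0 1 2 [], Fwd (-3) 0 0 2 0 []]]"
  "check_roots 3 (walls 3) (- 3)
     [Fwd 0 0 2 0 0 [Fwd 4 0 2 0 0 [], Fwd 4 0 2 0 0 [], Fwd 4 0 2 0 0 [], Fwd 4 0 2 0 0 []], Fwd 2 0 2 0 0
      [Fwd 4 0 2 0 0 [], Fwd 4 0 2 0 0 []], Fwd 3 0 2 0 0 [Fwd 4 0 2 0 0 []], Fwd 4 0 2 0 0 [], Fwd 2 3 0 0 0
      [Fwd (-3) 0 0 2 0 [], Fwd (-3) 0 0 2 0 []], Fwd 0 3 0 0 0 [Fwd (-3) 0 0 2 0 [Fwd 4 0 2 0 0 [], Fwd 4 4 2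
      0 0 []], Fwd (-3) 0 0 2 0 [], Fwd (-3) 0 0 2 0 [], Fwd (-3) 0 0 2 0 []], Fwd (-2) 3 0 0 0 [Bwd 3 2 0 0 0
      [Bwd (-2) 3 4 4 1 [Bwd 1 6 0 2 0 [Bwd 0 3 1 8 1 [Bwd 0 5 0 2 0 []]]]], Fwd (-3) 0 0 1 2 [Fwd 4 0 2 0 0
      [], Fwd 4 0 2 0 0 []], Fwd (-3) 0 0 2 0 [], Fwd (-3) 0 0 2 0 [], Fwd (-3) 0 0 2 0 [], Fwd (-3) 0 0 2 0
      []]]"
  by code_simp+

lemma check_roots_4:
  "check_roots 4 (walls 4) 4
     [Bwd (-3) 3 0 0 4 [Bwd 2 2 0 1 2 [Bwd (-1) 0 4 4 2 [Bwd 1 5 0 2 0 []]], Bwd 0 2 0 1 2 [Bwd 2 8 0 0 4 [Bwd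
      (-2) 5 6 3 1 [Bwd 1 5 0 1 2 [Bwd 1 5 0 10 8 []]]]]], Bwd (-4) 0 0 0 4 [Bwd 4 2 0 0 0 [Bwd (-3) 3 4 4 1
      [Bwd 2 6 0 2 0 [Bwd (-1) 0 4 8 2 [Bwd 1 5 0 2 0 []]]]], Fwd (-2) 6 1 1 2 [Fwd 5 0 2 0 0 [], Fwd 5 0 2 0
      0 [], Fwd 4 0 2 0 0 [Fwd (-4) 0 0 1 4 []], Fwd 3 3 4 1 3 [Fwd (-4) 0 0 1 3 []]], Fwd 0 6 1 1 2 [Fwd 4 0
      4 0 0 [Fwd (-4) 0 0 1 4 []]]], Fwd (-4) 0 0 3 0 [Fwd 5 0 6 0 0 [], Fwd 5 2 1 0 0 [], Fwd 5 2 1 0 0 [],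
      Fwd 5 2 1 0 0 [], Bwd (-4) 0 0 2 1 []], Fwd (-4) 0 0 3 0 [Fwd 5 0 6 0 0 [], Fwd 5 2 1 0 0 []], Fwd (-4)
      0 0 0 2 [], Fwd (-4) 0 0 0 4 [], Fwd (-4) 0 0 0 4 [], Fwd (-4) 0 0 0 4 [], Fwd (-4) 0 0 0 4 []]"
  "check_roots 4 (walls 4) (- 4)
     [Fwd 5 0 4 0 0 [], Fwd 5 0 4 0 0 [], Fwd 5 0 4 0 0 [], Fwd 5 0 4 0 0 [], Fwd 5 0 2 0 0 [], Fwd 4 3 0 0 0
      [Fwd (-4) 0 0 2 0 []], Fwd 1 3 0 0 0 [Bwd 5 2 0 0 0 [], Fwd (-4) 0 0 2 0 [], Fwd (-4) 0 0 2 0 [], Fwd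
      (-4) 0 0 2 0 []], Fwd (-1) 3 0 4 1 [Bwd 5 2 0 0 0 [], Fwd (-4) 0 0 2 0 [Fwd 5 0 2 0 0 []], Fwd (-4) 0 0
      2 0 [], Fwd (-4) 0 0 2 0 [], Fwd (-4) 0 0 2 0 []], Bwd 2 0 4 0 0 [Fwd (-1) 0 2 6 0 [Fwd (-4) 0 0 1 4
      [Fwd 5 0 2 0 0 [], Fwd 5 0 2 0 0 []]], Bwd (-1) 3 0 2 1 [Bwd 0 4 0 2 0 [Bwd 1 2 0 3 1 [Bwd (-1) 5 0 0 3
      [Bwd 1 5 0 1 2 [Bwd 0 3 4 0 7 []]]]]], Fwd (-3) 5 2 2 1 [Bwd (-3) 1 4 4 0 [Bwd 2 6 0 3 0 [Bwd (-1) 0 5 8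
      2 [Bwd 1 5 0 2 0 []]]]]]]"
  by code_simp+

lemma check_roots_5:
  "check_roots 5 (walls 5) 5
     [Bwd (-4) 3 0 0 4 [Bwd 3 2 0 1 2 [Bwd (-2) 0 4 4 1 [Bwd 2 5 0 2 0 [], Fwd 4 3 1 1 6 [Fwd (-1) 0 8 6 3
      [Fwd (-3) 0 5 1 10 [Fwd 6 0 2 0 0 []]]]]], Bwd 1 2 0 1 2 [Bwd 1 2 0 4 1 [Bwd (-2) 5 0 3 1 [Bwd 2 2 0 7 8
      [Fwd 3 7 2 2 0 [Fwd 2 2 9 1 4 [Fwd (-5) 0 0 1 3 []]]]]]], Fwd 2 0 6 1 2 [Fwd 4 0 4 0 0 [Fwd (-5) 0 0 1 3
      [], Fwd (-5) 0 0 1 3 []]]], Bwd (-5) 0 0 0 4 [Bwd 5 2 0 0 0 [Bwd (-4) 3 4 4 1 [Bwd 3 6 0 2 0 [Bwd (-2) 0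
      4 8 5 [Bwd 2 5 0 2 0 []]]]], Bwd 2 2 0 1 2 [Fwd 1 2 0 0 4 [Fwd 4 0 4 4 2 [Fwd (-5) 0 0 1 3 []]], Bwd
      (-2) 3 1 4 1 [Bwd 2 5 0 2 0 [], Bwd 0 6 0 2 0 [Bwd 1 2 0 3 1 [Bwd (-1) 5 0 0 3 [Bwd 1 5 0 1 2 [Bwd 0 3 4
      0 7 []]]]]]], Fwd 0 6 1 1 2 [Fwd 6 0 4 0 0 [], Fwd 4 0 4 0 0 [Fwd (-5) 0 0 1 3 [], Fwd (-5) 0 0 1 3
      []]]], Fwd (-5) 0 0 3 0 [Fwd 6 2 1 0 0 [], Fwd 6 2 1 0 0 [], Fwd 6 2 1 0 0 [], Fwd 6 2 1 0 0 [], Fwd 6 2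
      1 0 0 [], Fwd 4 0 2 0 0 [Fwd (-5) 0 0 4 3 [], Fwd (-5) 0 0 1 3 []], Bwd (-5) 0 0 2 1 []], Fwd (-5) 0 0 3
      0 [Fwd 6 0 6 0 0 [], Fwd 6 2 1 0 0 [], Fwd 6 2 1 0 0 [], Fwd 6 2 1 0 0 []], Fwd (-5) 0 0 3 0 [Fwd 6 0 6
      0 0 [], Fwd 6 2 1 0 0 []], Fwd (-5) 0 0 0 2 [], Fwd (-5) 0 0 0 4 [], Fwd (-5) 0 0 0 4 [], Fwd (-5) 0 0 0
      4 [], Fwd (-5) 0 0 0 4 [], Fwd (-5) 0 0 0 4 []]"
  "check_roots 5 (walls 5) (- 5)
     [Fwd 6 0 4 0 0 [], Fwd 6 0 4 0 0 [], Fwd 6 0 4 0 0 [], Fwd 6 0 4 0 0 [], Fwd 6 0 2 0 0 [], Fwd 6 0 2 0 0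
      [], Bwd 6 0 4 0 0 [], Fwd 3 3 0 0 0 [Fwd (-5) 0 0 2 0 [], Fwd (-5) 0 0 2 0 [], Fwd (-5) 0 0 2 0 []], Fwd
      0 3 0 0 0 [Bwd 6 2 0 0 0 [], Fwd (-5) 0 0 2 0 [Fwd 6 0 2 0 0 []], Fwd (-5) 0 0 2 0 [], Fwd (-5) 0 0 2 0
      [], Fwd (-5) 0 0 2 0 [], Fwd (-5) 0 0 2 0 []], Fwd (-2) 3 0 4 1 [Bwd 6 2 0 0 0 [], Fwd (-5) 0 0 1 2 [Fwd
      6 0 2 0 0 [], Fwd 6 0 2 0 0 [], Fwd 6 0 2 0 0 []], Fwd (-5) 0 0 2 0 [Fwd 6 0 2 0 0 []], Fwd (-5) 0 0 2 0
      [], Fwd (-5) 0 0 2 0 []], Bwd 3 0 4 0 0 [Bwd 0 6 0 2 1 [Bwd (-2) 2 0 3 1 [Bwd 3 2 0 4 2 [Bwd (-2) 5 0 4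
      1 [Bwd 1 6 0 1 2 [Bwd 1 6 3 12 1 []]]]]], Bwd (-2) 3 0 2 1 [Bwd 0 2 0 1 2 [Bwd 2 2 0 0 6 [Bwd (-3) 5 0 4
      1 [Fwd (-3) 4 10 6 0 [Fwd 0 2 1 1 12 [Fwd 4 0 10 4 8 [Fwd (-5) 0 0 1 4 []]]]]]]], Fwd (-4) 5 2 2 1 [Bwd
      (-4) 1 4 4 0 [Bwd 3 6 0 3 0 [Bwd (-2) 0 5 8 4 [Bwd 2 5 0 2 0 []]]]]]]"
  by code_simp+

lemma check_roots_6:
  "check_roots 6 (walls 6) 6
     [Bwd (-5) 3 0 0 4 [Bwd 4 2 0 1 2 [Bwd (-3) 0 4 4 1 [Bwd 3 5 0 2 0 [], Bwd 1 6 3 1 2 []]], Fwd 5 0 6 1 2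
      [Bwd 2 4 1 3 0 [Bwd 0 0 2 6 1 [Bwd (-1) 4 0 2 0 [Bwd 2 5 0 4 1 [Bwd (-2) 6 3 4 1 [Bwd 2 5 0 1 2 [Bwd
      (-1) 3 4 7 1 [Bwd 1 18 15 2 0 []]]]]]]]]], Bwd (-6) 0 0 0 4 [Bwd 6 2 0 0 0 [Bwd (-5) 3 4 4 1 [Bwd 4 6 0
      2 0 [Bwd (-3) 0 4 8 5 [Bwd 3 5 0 2 0 []]]]], Bwd 4 2 6 1 2 [Bwd (-2) 5 3 4 1 [Bwd 1 6 3 1 2 []]]], Bwd
      (-6) 0 0 0 4 [Bwd 5 2 0 1 2 [Bwd (-3) 2 0 4 1 [Bwd 1 2 0 1 2 [Bwd 1 2 0 8 1 [Bwd (-2) 5 0 3 1 [Bwd 3 6 0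
      1 2 [Fwd 1 1 2 6 14 [Fwd 4 0 16 1 7 [Fwd (-6) 0 0 1 3 []]]]]]]]]], Bwd (-6) 0 0 0 4 [], Bwd (-6) 0 0 0 4
      [], Bwd (-6) 0 0 0 4 [], Fwd (-6) 0 0 0 2 [], Fwd (-6) 0 0 0 4 [], Fwd (-6) 0 0 0 4 [], Fwd (-6) 0 0 0 4
      [], Fwd (-6) 0 0 0 4 [], Fwd (-6) 0 0 0 4 [], Fwd (-6) 0 0 0 4 []]"
  "check_roots 6 (walls 6) (- 6)
     [Fwd 7 0 4 0 0 [], Fwd 7 0 4 0 0 [], Fwd 7 0 4 0 0 [], Fwd 7 0 4 0 0 [], Fwd 7 0 4 0 0 [], Fwd 7 0 2 0 0
      [], Fwd 7 0 2 0 0 [], Bwd 7 0 4 0 0 [], Bwd 7 0 4 0 0 [], Bwd 7 0 4 0 0 [], Bwd 7 0 4 0 0 [], Bwd 6 0 4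
      0 0 [Bwd (-5) 0 2 2 1 [Bwd 4 2 0 2 0 [Bwd (-3) 0 4 4 2 [Bwd 3 5 0 2 0 [], Bwd 1 8 3 1 2 []]], Bwd 2 4 0
      1 2 [Bwd 0 2 0 6 1 [Bwd (-1) 5 0 2 0 [Bwd 2 5 0 4 1 [Bwd (-2) 6 3 4 1 [Bwd 2 5 0 1 2 [Bwd (-1) 3 4 7 1
      [Bwd 1 18 17 2 0 []]]]]]]]]], Fwd (-5) 3 0 0 4 [Bwd 6 2 0 0 0 [Bwd (-5) 3 4 4 1 [Bwd 4 6 0 2 0 [Bwd (-3)
      0 4 8 5 [Bwd 3 5 0 2 0 []]]]], Bwd 5 2 0 1 2 [Bwd (-3) 2 0 4 1 [Bwd 1 2 0 1 2 [Bwd 1 2 0 8 1 [Bwd (-2) 5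
      0 3 1 [Bwd 3 6 0 1 2 [Fwd 1 1 2 6 14 [Fwd 4 0 16 1 7 [Fwd (-6) 0 0 1 3 []]]]]]]]]]]"
  by code_simp+

lemma check_roots_7:
  "check_roots 7 (walls 7) 7
     [Bwd (-6) 3 0 0 4 [Bwd 5 2 0 1 2 [Bwd (-4) 0 4 4 1 [Bwd 4 5 0 2 0 [], Bwd 2 6 3 1 2 []]], Bwd 3 2 0 1 2
      [Bwd (-1) 0 3 4 1 [Bwd 0 5 0 2 0 [Bwd 1 2 0 4 1 [Bwd (-1) 6 3 0 3 [Bwd 1 5 0 1 2 [Bwd 0 3 4 0 7
      []]]]]]]], Bwd (-7) 0 0 0 4 [Bwd 7 2 0 0 0 [Bwd (-6) 3 4 4 1 [Bwd 5 6 0 2 0 [Bwd (-4) 0 4 8 1 [Bwd 4 5 0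
      2 0 [], Bwd 2 10 3 1 2 []]]]], Bwd 4 2 0 1 2 [Fwd 3 2 0 0 4 [Fwd 2 0 3 4 2 [Fwd (-7) 0 0 8 0 [], Fwd
      (-7) 0 0 1 3 []]], Bwd (-3) 5 3 4 1 [Bwd 2 6 3 1 2 []]]], Bwd (-7) 0 0 0 4 [Bwd 6 2 0 1 2 [Bwd (-4) 2 0
      4 1 [Bwd 2 2 0 1 2 [Bwd 0 2 0 8 1 [Bwd (-1) 5 0 2 0 [Bwd 2 5 0 4 1 [Bwd (-2) 6 3 4 1 [Bwd 2 5 0 1 2 [Bwd
      (-1) 3 4 7 1 [Bwd 1 20 14 2 0 []]]]]]]]]]], Bwd (-7) 0 0 0 4 [Bwd 6 2 6 1 2 [Fwd (-4) 8 0 3 4 [Fwd 8 0 3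
      0 0 [], Fwd 8 0 3 0 0 [], Fwd 8 0 3 0 0 [], Fwd 8 6 1 0 0 []]]], Bwd (-7) 0 0 0 4 [], Bwd (-7) 0 0 0 4
      [], Bwd (-7) 0 0 0 4 [], Fwd (-7) 0 0 0 2 [], Fwd (-7) 0 0 0 2 [], Fwd (-7) 0 0 0 4 [], Fwd (-7) 0 0 0 4
      [], Fwd (-7) 0 0 0 4 [], Fwd (-7) 0 0 0 4 [], Fwd (-7) 0 0 0 4 [], Fwd (-7) 0 0 0 4 []]"
  "check_roots 7 (walls 7) (- 7)
     [Fwd 8 0 4 0 0 [], Fwd 8 0 4 0 0 [], Fwd 8 0 4 0 0 [], Fwd 8 0 4 0 0 [], Fwd 8 0 4 0 0 [], Fwd 8 0 4 0 0
      [], Fwd 8 0 2 0 0 [], Fwd 8 0 2 0 0 [], Fwd 8 3 0 0 0 [], Bwd 8 0 4 0 0 [], Bwd 8 0 4 0 0 [], Bwd 8 0 4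
      0 0 [], Bwd 7 0 4 0 0 [Fwd 0 0 2 6 3 [Fwd (-7) 0 0 4 0 [Fwd 8 0 2 0 0 [], Fwd 8 0 2 0 0 []], Fwd (-7) 0
      0 1 3 [], Fwd (-7) 0 0 1 3 [], Fwd (-7) 0 0 1 3 []]], Bwd 7 0 4 0 0 [Bwd (-6) 0 2 2 1 [Bwd 5 2 0 2 0
      [Bwd (-4) 0 4 4 2 [Bwd 4 5 0 2 0 [], Bwd 2 8 3 1 2 []]], Bwd 3 4 0 1 2 [Bwd (-1) 0 3 6 1 [Bwd 0 5 0 2 0
      [Bwd 1 2 0 4 1 [Bwd (-1) 6 3 0 3 [Bwd 1 5 0 1 2 [Bwd 0 3 4 0 7 []]]]]]]]], Bwd 6 0 4 0 0 [Bwd (-4) 3 0 2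
      1 [Bwd 2 2 0 1 2 [Bwd 0 2 0 6 1 [Bwd (-1) 5 0 2 0 [Bwd 2 5 0 4 1 [Bwd (-2) 6 3 4 1 [Bwd 2 5 0 1 2 [Bwd
      (-1) 3 4 7 1 [Bwd 1 18 14 2 0 []]]]]]]]], Fwd (-6) 5 2 2 1 [Bwd (-6) 1 4 4 0 [Bwd 5 6 0 3 0 [Bwd (-4) 0
      5 8 1 [Bwd 4 5 0 2 0 [], Bwd 2 10 3 1 2 []]]]]]]"
  by code_simp+

lemma check_roots_8:
  "check_roots 8 (walls 8) 8
     [Bwd (-7) 3 0 0 4 [Bwd 6 2 0 1 2 [Bwd (-5) 0 4 4 1 [Bwd 5 5 0 2 0 [], Bwd 2 6 0 1 2 [Fwd 7 5 0 0 8 [Fwd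
      (-4) 0 10 7 2 [Fwd 0 9 4 1 12 [Fwd 6 0 14 1 4 [Fwd (-8) 0 0 1 3 []]]]]]]], Bwd 4 2 6 1 2 [Fwd 6 8 0 3 4
      [Fwd (-1) 0 3 10 2 [Fwd (-7) 0 7 1 5 [Fwd 9 0 2 0 0 [], Fwd 9 0 2 0 0 [], Fwd 9 0 2 0 0 []], Fwd (-8) 0
      0 1 5 []], Bwd (-1) 1 5 6 1 []]]], Bwd (-8) 0 0 0 4 [Bwd 8 2 0 0 0 [Bwd (-7) 3 4 4 1 [Bwd 6 6 0 2 0 [Bwd
      (-5) 0 4 8 1 [Bwd 5 5 0 2 0 [], Bwd 3 10 7 1 2 []]]]], Bwd 5 2 0 1 2 [Fwd 4 8 0 0 4 [Bwd (-2) 1 2 0 4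
      [Bwd 0 8 0 1 2 [Bwd 2 5 0 3 1 [Bwd (-3) 5 0 3 1 [Bwd 4 5 0 8 5 []]]]]], Bwd (-4) 5 3 4 1 [Bwd 2 5 0 1 2
      [Fwd 5 5 0 0 8 [Fwd (-1) 0 10 1 2 [Fwd (-4) 3 4 1 12 [Fwd 9 0 2 0 0 []]]]]]]], Bwd (-8) 0 0 0 4 [Bwd 7 2
      0 1 2 [Bwd (-5) 2 0 4 2 [Bwd 3 2 0 1 2 [Bwd (-1) 0 3 8 1 [Bwd 0 5 0 2 0 [Bwd 1 2 0 4 1 [Bwd (-1) 6 3 0 3
      [Bwd 1 5 0 1 2 [Bwd 0 3 4 0 7 []]]]]]]]], Bwd 5 2 0 3 1 [Bwd (-2) 8 0 4 1 [Fwd 2 10 1 2 6 [Fwd 4 0 2 1 3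
      [Fwd (-8) 0 0 1 4 [], Fwd (-8) 0 0 1 3 []]]]]], Bwd (-8) 0 0 0 4 [Bwd 7 2 6 1 2 [Bwd (-5) 2 0 3 1 [Bwd 3
      2 0 1 2 [Bwd (-1) 0 3 7 2 [Bwd 0 5 0 2 0 [Bwd 1 2 0 4 1 [Bwd (-1) 6 3 0 3 [Bwd 1 5 0 1 2 [Bwd 0 3 4 0 7
      []]]]]]], Fwd 0 3 1 1 6 [Fwd 7 0 5 5 3 [Fwd (-8) 0 0 1 3 []]]]]], Bwd (-8) 0 0 0 4 [], Bwd (-8) 0 0 0 4
      [], Bwd (-8) 0 0 0 4 [], Bwd (-8) 0 0 0 4 [], Fwd (-8) 0 0 0 2 [], Fwd (-8) 0 0 0 2 [], Fwd (-8) 0 0 0 4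
      [], Fwd (-8) 0 0 0 4 [], Fwd (-8) 0 0 0 4 [], Fwd (-8) 0 0 0 4 [], Fwd (-8) 0 0 0 4 [], Fwd (-8) 0 0 0 4
      [], Fwd (-8) 0 0 0 4 []]"
  "check_roots 8 (walls 8) (- 8)
     [Fwd 9 0 4 0 0 [], Fwd 9 0 4 0 0 [], Fwd 9 0 4 0 0 [], Fwd 9 0 4 0 0 [], Fwd 9 0 4 0 0 [], Fwd 9 0 4 0 0
      [], Fwd 9 0 4 0 0 [], Fwd 9 0 2 0 0 [], Fwd 9 0 2 0 0 [], Fwd 9 3 0 0 0 [], Bwd 9 0 4 0 0 [], Bwd 9 0 4
      0 0 [], Bwd 9 0 4 0 0 [], Bwd 9 0 4 0 0 [], Bwd 8 0 4 0 0 [Fwd (-1) 0 2 6 3 [Fwd (-8) 0 0 1 4 [Fwd 9 0 2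
      0 0 [], Fwd 9 0 2 0 0 [], Fwd 9 0 2 0 0 [], Fwd 9 0 2 0 0 []], Fwd (-8) 0 0 1 8 [], Fwd (-8) 0 0 1 3 [],
      Fwd (-8) 0 0 1 3 []]], Bwd 7 0 4 0 0 [Fwd (-3) 0 2 6 0 [Fwd (-4) 0 2 1 4 [Fwd 9 0 2 0 0 [], Fwd 9 0 2 0
      0 []]], Bwd (-7) 0 2 2 1 [Bwd 6 2 0 2 0 [Bwd (-5) 0 4 4 2 [Bwd 5 5 0 2 0 [], Fwd (-4) 1 8 4 1 [Bwd 2 1 2
      3 1 [Fwd 0 7 0 0 12 [Fwd 6 0 14 1 2 [Fwd (-8) 0 0 1 3 []]]]]]], Bwd 4 4 3 1 2 [Bwd (-1) 5 3 6 5 []]]],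
      Bwd 7 0 4 0 0 [Bwd (-5) 3 0 2 1 [Bwd 3 2 0 1 2 [Bwd (-1) 0 3 6 1 [Bwd 0 5 0 2 0 [Bwd 1 2 0 4 1 [Bwd (-1)
      6 3 0 3 [Bwd 1 5 0 1 2 [Bwd 0 3 4 0 7 []]]]]]], Fwd (-5) 1 4 3 1 [Fwd 0 5 3 1 6 [Fwd 7 0 7 7 5 [Fwd (-8)
      0 0 1 3 []]]]], Fwd (-7) 5 2 2 1 [Bwd (-7) 1 4 4 0 [Bwd 6 6 0 3 0 [Bwd (-5) 0 5 8 1 [Bwd 5 5 0 2 0 [],
      Bwd 3 10 6 1 2 []]]]]]]"
  by code_simp+

lemma check_roots_9:
  "check_roots 9 (walls 9) 9
     [Bwd (-8) 3 0 0 4 [Bwd 7 2 0 1 2 [Bwd (-6) 0 4 4 1 [Bwd 6 5 0 2 0 [], Bwd 3 6 0 1 2 [Fwd 8 5 0 0 8 [Fwd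
      (-5) 0 10 7 2 [Fwd 1 10 4 1 12 [Fwd 5 0 14 1 6 [Fwd (-9) 0 0 1 3 []]]]]]]], Bwd 4 2 0 1 2 [Bwd 0 2 0 4 2
      [], Bwd (-3) 3 1 4 1 [Bwd 2 5 0 10 5 [], Bwd 0 6 0 1 2 [Bwd 2 5 0 3 1 [Bwd (-3) 5 0 3 1 [Bwd 4 5 0 1 2
      [Fwd 8 14 1 13 4 [Bwd (-4) 0 2 6 1 [Bwd 4 8 3 1 4 [Bwd (-3) 3 6 10 1 [Bwd 2 12 0 2 0 [Bwd 0 19 0 0 17
      []]]]]]]]]]]]], Bwd (-9) 0 0 0 4 [Bwd 9 2 0 0 0 [Bwd (-8) 3 4 4 1 [Fwd 6 3 1 9 6 [Bwd 7 0 2 3 0 [Bwd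
      (-6) 0 2 2 1 [Bwd 6 4 0 2 0 [], Bwd 4 12 9 1 2 []]]]]], Bwd 6 2 0 1 2 [Bwd (-3) 2 0 4 1 [Fwd 5 4 1 2 6
      [Bwd 1 8 1 3 0 [Bwd 1 3 0 2 1 [Bwd (-2) 4 0 3 1 [Bwd 3 5 0 1 2 [Fwd 1 8 7 1 2 [Fwd (-9) 0 0 1 9 [Fwd 10
      0 2 0 0 [], Fwd 10 0 2 0 0 []]]]]]]]], Bwd (-5) 5 3 4 1 [Bwd 3 5 0 1 2 [Fwd 6 5 0 0 8 [Fwd (-2) 0 10 7 2
      [Fwd (-4) 0 4 1 12 [Fwd 10 0 2 0 0 [], Fwd 10 14 5 0 0 []]]]]]], Bwd 4 2 0 6 1 [Bwd 0 8 0 4 8 []]], Bwd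
      (-9) 0 0 0 4 [Bwd 8 2 0 1 2 [Bwd (-6) 2 0 4 2 [Bwd 4 2 0 1 2 [Bwd (-2) 0 3 8 2 [Bwd 1 5 0 2 0 [Bwd 0 4 1
      4 1 [Bwd 0 6 3 2 0 []]]]]]], Bwd 6 2 0 3 1 [Bwd (-3) 8 0 4 1 [Bwd 1 6 3 1 2 [Bwd 1 5 0 3 1 [Bwd (-2) 5 0
      3 1 [Bwd 3 5 0 1 2 [Fwd 3 7 1 10 7 [Fwd 4 15 9 3 7 [Fwd (-9) 0 0 1 3 []]]]]]]]]], Bwd (-9) 0 0 0 4 [Bwd
      7 2 0 1 2 [Bwd (-4) 2 0 4 2 [Fwd 0 4 2 2 0 [Fwd 9 0 2 0 0 [Fwd (-9) 0 0 1 3 []]]], Bwd (-6) 2 0 3 1 [Bwd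
      4 2 0 1 2 [Bwd (-2) 0 3 7 2 [Bwd 1 5 0 2 0 [Bwd 0 4 1 4 1 [Bwd 0 6 3 2 0 []]]]], Fwd 1 3 1 1 6 [Fwd 6 0
      5 1 3 [Fwd (-9) 0 0 1 3 [], Fwd (-9) 0 0 1 3 []]]]]], Bwd (-9) 0 0 0 4 [], Bwd (-9) 0 0 0 4 [], Bwd (-9)
      0 0 0 4 [], Bwd (-9) 0 0 0 4 [], Bwd (-9) 0 0 0 4 [], Fwd (-9) 0 0 0 2 [], Fwd (-9) 0 0 0 2 [], Fwd (-9)
      0 0 0 4 [], Fwd (-9) 0 0 0 4 [], Fwd (-9) 0 0 0 4 [], Fwd (-9) 0 0 0 4 [], Fwd (-9) 0 0 0 4 [], Fwd (-9)
      0 0 0 4 [], Fwd (-9) 0 0 0 4 [], Fwd (-9) 0 0 0 4 []]"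
  "check_roots 9 (walls 9) (- 9)
     [Fwd 10 0 4 0 0 [], Fwd 10 0 4 0 0 [], Fwd 10 0 4 0 0 [], Fwd 10 0 4 0 0 [], Fwd 10 0 4 0 0 [], Fwd 10 0
      4 0 0 [], Fwd 10 0 4 0 0 [], Fwd 10 0 2 0 0 [], Fwd 10 0 2 0 0 [], Fwd 10 0 2 0 0 [], Fwd 10 3 0 0 0 [],
      Bwd 10 0 4 0 0 [], Bwd 10 0 4 0 0 [], Bwd 10 0 4 0 0 [], Bwd 10 0 4 0 0 [], Bwd 10 0 4 0 0 [], Bwd 9 0 4
      0 0 [Bwd (-8) 0 2 2 1 [Fwd (-1) 2 0 0 5 [Fwd (-9) 0 0 1 2 [], Fwd (-9) 0 0 1 2 [], Fwd (-9) 0 0 1 2 [],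
      Fwd (-9) 0 0 1 2 []], Bwd 4 2 0 1 2 [Bwd 0 2 0 6 2 [], Bwd (-3) 3 1 4 1 [Bwd 2 5 0 7 5 [], Fwd (-2) 6 3
      3 1 [Fwd (-5) 0 3 1 10 [Fwd 10 0 2 0 0 []]]]]]], Bwd 8 0 4 0 0 [Bwd (-6) 3 0 2 1 [Fwd (-3) 2 0 8 1 [Fwd
      (-7) 10 4 1 2 [Fwd 10 0 2 0 0 [], Fwd 10 0 2 0 0 []]], Bwd 2 4 0 3 1 [Bwd 1 2 0 6 1 [Bwd (-3) 5 0 7 1
      [Bwd 4 2 0 8 2 [Bwd (-3) 9 12 12 2 []]]]]], Bwd (-8) 0 2 2 1 [Bwd 7 2 0 2 0 [Bwd (-6) 0 4 4 2 [Bwd 6 5 0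
      2 0 [], Bwd 3 6 0 1 2 [Fwd (-5) 0 10 5 0 [Fwd 1 8 2 1 12 [Fwd 5 0 14 1 4 [Fwd (-9) 0 0 1 3 []]]]]]], Bwd
      5 4 3 1 2 [Bwd (-2) 5 3 4 1 [Bwd 0 8 0 1 2 [Bwd 2 5 0 3 1 [Bwd (-3) 5 0 3 1 [Bwd 4 5 0 1 2 [Bwd (-4) 9 0
      7 1 [Bwd 4 9 0 1 2 [Bwd (-3) 3 4 8 1 [Bwd 2 10 0 2 0 [Bwd 0 17 0 0 15 []]]]]]]]]]]]], Fwd (-8) 3 0 0 4
      [Bwd 9 2 0 0 0 [Bwd (-8) 3 4 4 1 [Fwd 6 3 1 9 6 [Bwd 7 0 2 3 0 [Bwd (-6) 0 2 2 1 [Bwd 6 4 0 2 0 [], Bwd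
      4 12 9 1 2 []]]]]], Bwd 8 2 0 1 2 [Bwd (-6) 2 0 4 2 [Bwd 4 2 0 1 2 [Bwd (-2) 0 3 8 2 [Bwd 1 5 0 2 0 [Bwd
      0 4 1 4 1 [Bwd 0 6 3 2 0 []]]]]]], Bwd 7 2 0 1 2 [Bwd (-4) 2 0 4 2 [Fwd 0 4 2 2 0 [Fwd 9 0 2 0 0 [Fwd
      (-9) 0 0 1 3 []]]], Bwd (-6) 2 0 3 1 [Bwd 4 2 0 1 2 [Bwd (-2) 0 3 7 2 [Bwd 1 5 0 2 0 [Bwd 0 4 1 4 1 [Bwd
      0 6 3 2 0 []]]]], Fwd 1 3 1 1 6 [Fwd 6 0 5 1 3 [Fwd (-9) 0 0 1 3 [], Fwd (-9) 0 0 1 3 []]]]]]]"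
  by code_simp+

lemma check_roots_10:
  "check_roots 10 (walls 10) 10
     [Bwd (-9) 3 0 0 4 [Bwd 8 2 0 1 2 [Bwd (-7) 0 4 4 1 [Bwd 7 5 0 2 0 [], Bwd 4 6 0 1 2 [Fwd 9 5 0 0 8 [Fwd
      (-6) 0 10 7 2 [Bwd (-2) 0 2 12 0 [Bwd 1 3 0 1 3 [Bwd 0 0 5 5 1 [Bwd 0 7 0 2 0 []]]]]]]]], Bwd 5 2 0 1 2
      [Bwd (-1) 2 0 4 2 [], Bwd (-4) 3 1 4 1 [Bwd 3 5 0 2 0 [], Bwd 1 6 3 1 2 [Bwd 1 5 0 3 1 [Bwd (-2) 5 0 3 1
      [Bwd 3 5 0 1 2 [Bwd (-3) 9 0 4 1 [Bwd 3 6 0 1 2 [Bwd (-2) 3 4 8 1 [Bwd 1 9 0 2 0 [Bwd 0 3 1 0 12 [Bwd 0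
      5 0 2 0 []]]]]]]]]]]], Bwd 4 2 6 6 1 []], Bwd (-10) 0 0 0 4 [Bwd 10 2 0 0 0 [Bwd (-9) 3 4 4 1 [Fwd 7 3 1
      9 6 [Bwd 8 0 2 3 0 [Bwd (-7) 0 2 2 1 [Bwd 7 4 0 2 0 [], Bwd 5 12 9 1 2 []]]]]], Bwd 7 2 0 1 2 [Bwd (-4)
      2 0 4 1 [Fwd 6 4 1 2 6 [Bwd 2 8 6 3 0 [Bwd 0 0 2 2 1 [Bwd (-1) 4 0 2 0 [Bwd 2 5 0 6 1 [Bwd (-2) 8 0 4 1
      [Bwd 2 5 0 1 2 [Bwd (-1) 3 4 0 11 []]]]]]]]], Bwd (-6) 5 3 4 1 [Bwd 4 5 0 1 2 [Fwd 7 5 0 0 8 [Bwd (-2) 2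
      0 10 1 [Bwd 1 2 0 1 2 [Bwd 0 0 4 4 1 [Bwd 0 6 0 2 0 []]]]]]]], Bwd 5 2 0 6 1 [Bwd (-1) 8 0 4 1 [Bwd (-2)
      6 0 3 1 [Bwd 4 2 0 0 8 [Bwd (-4) 5 0 4 1 [Bwd 4 12 16 1 2 []]]]]]], Bwd (-10) 0 0 0 4 [Bwd 9 2 0 1 2
      [Bwd (-7) 2 0 4 2 [Bwd 5 2 0 1 2 [Bwd (-3) 3 1 8 2 [Bwd 2 5 0 2 0 [Bwd (-1) 4 1 4 1 [Bwd 1 6 3 6 0
      []]]]]]], Bwd 7 2 6 3 1 [Bwd (-4) 2 0 4 1 [Bwd 1 2 0 1 2 [Bwd 2 2 0 7 2 [Bwd (-3) 2 10 3 1 [Bwd 4 6 3 3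
      1 []]], Bwd 0 2 0 3 1 [Bwd (-1) 5 0 2 0 [Bwd 2 5 0 7 1 [Fwd 3 7 1 13 7 [Fwd 6 0 9 3 0 [Fwd (-10) 0 0 1 3
      [], Fwd (-10) 0 0 1 3 []]]]]]]]]], Bwd (-10) 0 0 0 4 [Bwd 8 2 0 1 2 [Bwd (-5) 2 0 4 1 [Fwd 1 4 2 2 0
      [Fwd 8 0 2 1 4 [Fwd (-10) 0 0 1 3 [], Fwd (-10) 0 0 1 3 []]], Bwd 1 6 4 4 1 []], Bwd (-7) 2 0 3 1 [Bwd 5
      2 0 1 2 [Bwd (-3) 3 1 7 2 [Bwd 2 5 0 2 0 [Bwd (-1) 4 1 4 1 [Bwd 1 6 3 6 0 []]]]], Fwd 2 3 1 1 6 [Fwd 6 3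
      8 1 3 [Fwd (-10) 0 0 1 3 []]]]]], Bwd (-10) 0 0 0 4 [Fwd (-7) 6 3 1 2 [Fwd 11 0 2 0 0 [], Fwd 11 0 2 0 0
      [], Fwd 11 0 2 0 0 [], Fwd 11 0 2 0 0 [], Fwd 11 0 2 0 0 [], Fwd 11 0 2 0 0 [], Fwd 11 4 8 0 0 []]], Bwd
      (-10) 0 0 0 4 [], Bwd (-10) 0 0 0 4 [], Bwd (-10) 0 0 0 4 [], Bwd (-10) 0 0 0 4 [], Fwd (-10) 0 0 3 0
      [], Fwd (-10) 0 0 0 2 [], Fwd (-10) 0 0 0 2 [], Fwd (-10) 0 0 0 4 [], Fwd (-10) 0 0 0 4 [], Fwd (-10) 0
      0 0 4 [], Fwd (-10) 0 0 0 4 [], Fwd (-10) 0 0 0 4 [], Fwd (-10) 0 0 0 4 [], Fwd (-10) 0 0 0 4 [], Fwd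
      (-10) 0 0 0 4 [], Fwd (-10) 0 0 0 4 []]"
  "check_roots 10 (walls 10) (- 10)
     [Fwd 11 0 4 0 0 [], Fwd 11 0 4 0 0 [], Fwd 11 0 4 0 0 [], Fwd 11 0 4 0 0 [], Fwd 11 0 4 0 0 [], Fwd 11 0
      4 0 0 [], Fwd 11 0 4 0 0 [], Fwd 11 0 4 0 0 [], Fwd 11 0 2 0 0 [], Fwd 11 0 2 0 0 [], Fwd 11 0 2 0 0 [],
      Fwd 11 3 0 0 0 [], Bwd 11 0 4 0 0 [], Bwd 11 0 4 0 0 [], Bwd 11 0 4 0 0 [], Bwd 11 0 4 0 0 [], Bwd 11 0
      4 0 0 [], Bwd 10 0 4 0 0 [Bwd (-9) 0 2 2 1 [Fwd 5 2 0 0 5 [Fwd (-10) 0 0 1 2 []], Fwd 0 2 0 8 1 [Bwd 6 4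
      2 0 4 [], Fwd (-10) 0 0 1 2 [], Fwd (-10) 0 0 1 2 []], Bwd 4 4 8 8 1 []]], Bwd 10 0 4 0 0 [Bwd (-9) 0 2
      2 1 [Bwd 8 2 0 2 0 [Bwd (-7) 0 4 4 1 [Bwd 7 5 0 2 0 []]], Bwd 5 2 0 1 2 [Bwd (-1) 2 0 6 2 [], Bwd (-4) 3
      1 4 1 [Bwd 3 5 0 2 0 [], Fwd (-3) 6 3 3 1 [Fwd (-5) 0 3 8 5 [Fwd 11 0 2 0 0 [], Fwd 11 0 2 0 0 []]]]]]],
      Bwd 9 0 4 0 0 [Bwd (-7) 3 0 2 1 [Bwd 5 2 0 1 2 [Fwd (-4) 4 2 10 0 [Fwd (-7) 0 2 1 4 [Fwd 11 0 2 0 0 [],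
      Fwd 11 0 2 0 0 [], Fwd 11 0 2 0 0 []]]], Bwd 3 4 0 1 2 [Bwd 0 2 0 6 1 [Bwd (-2) 5 0 3 1 [Bwd 3 2 0 4 10
      [Bwd (-3) 2 0 4 2 [Bwd 3 2 0 1 2 [Bwd (-2) 3 4 4 1 [Bwd 1 6 0 2 0 [Bwd 0 3 1 8 2 [Bwd 0 5 0 2 0
      []]]]]]]]]]], Bwd (-9) 0 2 2 1 [Bwd 8 2 0 2 0 [Bwd (-7) 0 4 4 2 [Bwd 7 5 0 2 0 [], Bwd 4 6 0 1 2 [Fwd
      (-6) 0 10 5 0 [Bwd (-2) 2 1 12 0 [Bwd 1 3 0 1 3 [Bwd 0 0 5 5 1 [Bwd 0 7 0 2 0 []]]]]]]], Bwd 6 4 3 1 2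
      [Bwd (-3) 5 3 4 1 [Bwd 1 8 3 1 2 [Bwd 1 5 0 3 1 [Bwd (-2) 5 0 3 1 [Bwd 3 5 0 1 2 [Bwd (-3) 9 0 4 1 [Bwd
      3 6 0 1 2 [Bwd (-2) 3 4 8 1 [Bwd 1 9 0 2 0 [Bwd 0 3 1 0 12 [Bwd 0 5 0 2 0 []]]]]]]]]]]]]], Bwd 8 0 4 0 0
      [Bwd (-5) 3 0 2 1 [Bwd 2 2 0 8 2 [Bwd 1 2 0 4 2 [Bwd (-2) 6 4 4 1 []]], Bwd 1 4 8 8 1 []], Bwd (-7) 3 0
      2 1 [Bwd 5 2 0 1 2 [Bwd (-3) 3 1 6 2 [Bwd 2 5 0 2 0 [Bwd (-1) 4 1 4 1 [Bwd 1 6 3 6 0 []]]]], Fwd (-7) 1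
      4 3 1 [Fwd 2 5 3 1 6 [Fwd 6 3 8 1 5 [Fwd (-10) 0 0 1 3 []]]]], Fwd (-9) 5 2 2 1 [Bwd (-9) 1 4 4 0 [Fwd 7
      2 1 9 6 [Bwd 8 0 2 3 0 [Bwd (-7) 0 2 2 1 [Bwd 7 4 0 2 0 [], Bwd 5 12 8 1 2 []]]]]]]]"
  by code_simp+

lemma check_roots_11:
  "check_roots 11 (walls 11) 11
     [Bwd (-10) 3 0 0 4 [Bwd 9 2 0 1 2 [Bwd (-8) 0 4 4 1 [Bwd 8 5 0 2 0 [], Fwd 10 3 1 9 0 [Bwd 5 0 2 3 0 [Fwd
      (-7) 0 10 8 0 [Bwd (-3) 2 1 12 0 [Bwd 2 3 0 1 3 [Bwd (-1) 0 5 5 1 [Bwd 1 7 0 1 7 []]]]]]]]], Bwd 6 2 0 1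
      2 [Fwd 9 2 0 0 4 [Bwd (-2) 1 2 6 1 [Bwd (-1) 8 0 3 1 [Bwd 4 8 3 0 10 []]]], Bwd (-5) 3 1 4 1 [Bwd 4 5 0
      2 0 [], Bwd 2 6 3 1 2 [Bwd 0 2 0 3 1 [Bwd (-1) 5 0 2 0 [Bwd 2 5 0 7 1 [Bwd (-2) 9 0 4 1 [Bwd 2 5 0 1 2
      [Bwd (-1) 3 4 0 11 []]]]]]]]], Fwd 8 0 6 1 2 [Bwd 4 4 1 8 3 [Fwd (-1) 0 6 10 0 [Fwd (-9) 0 2 1 8 [Fwd 12
      0 2 0 0 [], Fwd 12 0 2 0 0 []]]]]], Bwd (-11) 0 0 0 4 [Bwd 11 2 0 5 2 [], Bwd 8 2 0 1 2 [Bwd (-5) 2 0 4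
      1 [Bwd 2 2 0 2 0 [Fwd 7 6 0 0 8 [Fwd (-1) 0 10 8 2 [Fwd (-7) 0 4 1 12 [Fwd 12 0 2 0 0 []]]], Bwd (-1) 3
      1 3 1 [Bwd 0 5 0 2 0 [Bwd 1 2 0 7 1 [Bwd (-1) 9 0 0 3 [Bwd 1 5 0 1 2 [Bwd 0 3 4 0 7 []]]]]]]], Bwd (-7)
      5 3 4 1 [Bwd 5 5 0 1 2 [Bwd (-3) 3 1 8 2 [Bwd 2 5 0 2 0 [Bwd (-1) 4 1 4 1 [Bwd 1 6 3 6 0 []]]]]]], Bwd 6
      2 0 6 1 [Bwd (-2) 8 0 4 1 [Bwd (-1) 6 0 3 1 [Bwd 3 2 0 0 8 [Bwd (-3) 5 0 0 14 []]]]]], Bwd (-11) 0 0 0 4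
      [Bwd 10 2 0 1 2 [Bwd (-8) 2 0 4 2 [Bwd 6 2 0 1 2 [Bwd (-4) 3 1 8 2 [Bwd 3 5 0 2 0 []]]]], Bwd 7 2 0 3 1
      [Fwd 4 2 0 0 4 [Fwd 4 0 4 4 2 [Fwd (-11) 0 0 1 6 []]], Bwd (-5) 2 0 4 1 [Bwd 2 2 0 2 0 [Bwd 1 2 0 7 2
      [Bwd (-3) 5 0 4 1 [Bwd 4 2 0 11 6 [Bwd (-4) 2 0 8 1 [Bwd 4 2 0 1 2 [Fwd 5 1 6 0 4 [Fwd 2 6 3 1 8 [Fwd
      (-11) 0 0 8 5 [Fwd 12 0 2 0 0 [], Fwd 12 0 2 0 0 []]]]]]]]], Bwd (-1) 3 1 3 1 [Bwd 0 5 0 2 0 [Bwd 1 2 0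
      7 1 [Bwd (-1) 9 0 0 3 [Bwd 1 5 0 1 2 [Bwd 0 3 4 0 7 []]]]]]]]]], Bwd (-11) 0 0 0 4 [Bwd 9 2 0 1 2 [Fwd 2
      2 0 0 4 [Fwd 7 0 4 1 2 [Fwd (-11) 0 0 1 3 [], Fwd (-11) 0 0 1 3 []], Bwd (-5) 1 2 6 1 []], Bwd (-8) 2 0
      3 1 [Bwd 6 2 0 1 2 [Bwd (-4) 3 1 7 2 [Bwd 3 5 0 2 0 []]], Fwd 3 3 1 1 6 [Fwd 5 0 8 1 3 [Fwd (-11) 0 0 1
      3 []]]]], Bwd 7 2 0 6 1 [Fwd 2 8 0 0 4 [Fwd 7 0 6 1 2 [Fwd (-11) 0 0 1 3 [], Fwd (-11) 0 0 1 3 []]]]],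
      Bwd (-11) 0 0 0 4 [Fwd (-7) 0 3 1 2 [Fwd 12 0 2 0 0 [], Fwd 12 0 2 0 0 [], Fwd 12 0 2 0 0 [], Fwd 12 0 2
      0 0 [], Fwd 12 0 2 0 0 [], Fwd 12 0 2 0 0 [], Fwd 12 0 2 0 0 [], Fwd 10 0 4 0 0 [Fwd (-11) 0 0 1 3 [],
      Fwd (-11) 0 0 1 3 []]]], Bwd (-11) 0 0 0 4 [], Bwd (-11) 0 0 0 4 [], Bwd (-11) 0 0 0 4 [], Bwd (-11) 0 0
      0 4 [], Bwd (-11) 0 0 0 4 [], Fwd (-11) 0 0 3 0 [], Fwd (-11) 0 0 0 2 [], Fwd (-11) 0 0 0 2 [], Fwd
      (-11) 0 0 0 2 [], Fwd (-11) 0 0 0 4 [], Fwd (-11) 0 0 0 4 [], Fwd (-11) 0 0 0 4 [], Fwd (-11) 0 0 0 4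
      [], Fwd (-11) 0 0 0 4 [], Fwd (-11) 0 0 0 4 [], Fwd (-11) 0 0 0 4 [], Fwd (-11) 0 0 0 4 [], Fwd (-11) 0
      0 0 4 []]"
  "check_roots 11 (walls 11) (- 11)
     [Fwd 12 0 4 0 0 [], Fwd 12 0 4 0 0 [], Fwd 12 0 4 0 0 [], Fwd 12 0 4 0 0 [], Fwd 12 0 4 0 0 [], Fwd 12 0
      4 0 0 [], Fwd 12 0 4 0 0 [], Fwd 12 0 4 0 0 [], Fwd 12 0 4 0 0 [], Fwd 12 0 2 0 0 [], Fwd 12 0 2 0 0 [],
      Fwd 12 0 2 0 0 [], Fwd 12 3 0 0 0 [], Bwd 12 0 4 0 0 [], Bwd 12 0 4 0 0 [], Bwd 12 0 4 0 0 [], Bwd 12 0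
      4 0 0 [], Bwd 12 0 4 0 0 [], Bwd 12 0 4 0 0 [], Bwd 11 0 4 0 0 [Bwd (-10) 0 2 2 1 [Fwd 4 2 0 0 5 [Fwd
      (-11) 0 0 1 2 []], Fwd (-1) 2 0 8 1 [Bwd 7 4 2 0 4 [], Fwd (-11) 0 0 1 2 [], Fwd (-11) 0 0 1 2 [], Fwd
      (-11) 0 0 1 2 []], Bwd 4 4 0 8 1 [Fwd (-1) 0 6 10 0 [Fwd (-9) 0 2 1 8 [Fwd 12 0 2 0 0 [], Fwd 12 0 2 0 0
      []]]]]], Bwd 10 0 4 0 0 [Fwd (-3) 0 2 6 0 [Fwd (-7) 0 2 1 4 [Fwd 12 0 2 0 0 [], Fwd 12 0 2 0 0 [], Fwd
      12 0 2 0 0 []]], Bwd (-10) 0 2 2 1 [Bwd 9 2 0 2 0 [Bwd (-8) 0 4 4 1 [Bwd 8 5 0 2 0 []]], Bwd 6 2 0 1 2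
      [Bwd (-2) 2 0 6 1 [Bwd (-1) 8 0 3 1 [Bwd 4 6 3 0 10 []]], Bwd (-5) 3 1 4 1 [Bwd 4 5 0 2 0 [], Bwd 2 6 3
      1 2 [Bwd 0 2 0 3 1 [Bwd (-1) 5 0 2 0 [Bwd 2 5 0 7 1 [Bwd (-2) 9 0 4 1 [Bwd 2 5 0 1 2 [Bwd (-1) 3 4 0 11
      []]]]]]]]]]], Bwd 10 0 4 0 0 [Bwd (-8) 3 0 2 1 [Bwd 6 2 0 1 2 [Bwd (-4) 3 1 4 2 [Bwd 3 5 0 2 0 []]], Bwd
      4 4 0 1 2 [Bwd (-1) 2 0 6 1 [Bwd (-1) 5 0 3 1 [Bwd 3 9 0 4 1 [Bwd (-4) 6 3 4 1 [Bwd 5 6 0 12 6 []]]]]]],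
      Bwd (-10) 0 2 2 1 [Bwd 9 2 0 2 0 [Bwd (-8) 0 4 4 2 [Bwd 8 5 0 2 0 [], Bwd 5 6 0 1 2 [Fwd (-7) 0 10 6 0
      [Bwd (-3) 2 1 12 0 [Bwd 2 3 0 1 3 [Bwd (-1) 0 5 5 1 [Bwd 1 7 0 1 7 []]]]]]]], Bwd 7 4 3 1 2 [Bwd (-4) 5
      3 4 1 [Bwd 2 8 3 1 2 [Bwd 0 2 0 3 1 [Bwd (-1) 5 0 2 0 [Bwd 2 5 0 7 1 [Bwd (-2) 9 0 4 1 [Bwd 2 5 0 1 2
      [Bwd (-1) 3 4 0 11 []]]]]]]]]]], Bwd 9 0 4 3 0 [Bwd (-6) 3 0 2 1 [Bwd 3 2 0 1 2 [Bwd 0 2 0 4 2 [Bwd (-2)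
      5 0 3 1 [Bwd 3 2 0 8 6 [Bwd (-3) 2 0 4 2 [Bwd 3 2 0 1 2 [Bwd (-2) 3 4 4 1 [Bwd 1 6 0 2 0 [Bwd 0 3 1 8 2
      [Bwd 0 5 0 2 0 []]]]]]]]]], Bwd 1 4 0 3 1 [Bwd 3 5 0 6 5 []]], Bwd (-8) 3 0 2 1 [Bwd 6 2 0 1 2 [Bwd (-4)
      3 1 6 2 [Bwd 3 5 0 2 0 []]], Fwd (-8) 1 4 3 1 [Fwd 3 5 3 1 6 [Fwd 5 0 8 1 5 [Fwd (-11) 0 0 1 3 []]]]]]]"
  by code_simp+

lemma check_roots_12:
  "check_roots 12 (walls 12) 12
     [Bwd (-11) 3 0 0 4 [Bwd 10 2 0 1 2 [Bwd (-9) 0 4 4 1 [Bwd 9 5 0 2 0 [], Fwd 11 3 1 9 0 [Bwd 6 0 2 3 0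
      [Bwd (-4) 0 2 10 3 [Bwd 3 4 0 2 0 []]]]]], Bwd 7 2 0 1 2 [Bwd (-3) 2 0 4 1 [Bwd 0 6 0 3 1 [Bwd 3 6 3 0 8
      []]], Bwd (-6) 3 1 4 1 [Bwd 5 5 0 2 0 [], Bwd 3 6 3 2 0 [Bwd (-1) 3 1 3 1 [Bwd 0 5 0 2 0 [Bwd 1 2 0 7 1
      [Bwd (-1) 9 0 0 3 [Bwd 1 5 0 1 2 [Bwd 0 3 4 0 7 []]]]]]]]], Fwd 9 0 6 1 2 [Bwd 5 4 1 1 3 [Bwd (-1) 3 0 6
      3 [Bwd (-2) 2 0 5 1 [Bwd 4 2 0 4 2 [Bwd (-4) 6 0 4 1 [Bwd 4 6 11 1 2 []]]]]]]], Bwd (-11) 3 0 0 4 [Bwd 9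
      2 0 1 2 [Bwd (-6) 2 0 4 1 [Bwd 3 2 0 1 2 [Fwd 8 6 0 0 8 [Fwd (-2) 0 10 8 2 [Fwd (-6) 10 4 1 12 [Fwd 13 0
      2 0 0 []]]]]], Bwd (-8) 5 3 4 1 [Bwd 6 5 0 1 2 [Bwd (-4) 3 1 8 2 [Bwd 3 5 0 2 0 []]]]], Bwd 7 2 0 3 1
      [Bwd (-3) 8 0 4 1 [Bwd 0 6 0 3 1 [Bwd 2 2 0 0 8 [Bwd (-2) 5 0 7 1 []]]]]], Bwd (-12) 0 0 0 4 [Bwd 11 2 0
      1 2 [Bwd (-9) 2 0 4 2 [Bwd 7 2 0 1 2 [Bwd (-5) 3 1 4 2 [Bwd 4 5 0 2 0 [], Fwd 6 4 1 1 10 [Fwd 1 0 12 6 3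
      [Fwd (-10) 0 5 14 0 [Fwd 13 0 2 0 0 []]]]]]]], Bwd 8 2 0 3 1 [Bwd (-4) 2 0 4 2 [Bwd 1 6 0 4 2 []], Bwd
      (-6) 2 0 4 1 [Bwd 3 2 0 1 2 [Bwd 0 2 0 7 2 [Bwd (-2) 5 0 3 1 [Bwd 3 2 0 4 12 [Fwd 5 8 2 2 0 [Fwd 4 2 1 1
      4 [Fwd (-12) 0 0 1 3 []]]]]]]]], Bwd 7 2 6 3 1 [Bwd (-3) 8 0 3 1 [Bwd 0 5 0 3 1 [Bwd 3 12 7 7 5 []]]]],
      Bwd (-12) 0 0 0 4 [Bwd 10 2 0 1 2 [Fwd 3 2 0 0 4 [Fwd 6 0 4 4 2 [Fwd (-12) 0 0 1 3 [], Fwd (-12) 0 0 1 3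
      []]], Bwd (-9) 2 0 3 1 [Bwd 7 2 0 1 2 [Bwd (-5) 3 1 7 2 [Bwd 4 5 0 2 0 []]], Fwd 4 3 1 1 6 [Fwd 4 0 8 1
      3 [Fwd (-12) 0 0 1 7 []]]]], Bwd 8 2 0 3 1 [Bwd (-4) 2 0 4 8 [Bwd 1 5 0 1 2 [Bwd 2 12 3 3 1 [Bwd (-3) 6
      3 3 1 [Bwd 4 5 3 3 1 []]]]], Bwd (-6) 5 0 3 1 [Bwd 4 5 3 1 2 []]]], Bwd (-12) 0 0 0 4 [Bwd 10 2 6 1 2
      [Bwd (-7) 2 0 4 1 [Fwd (-2) 4 2 2 0 [Fwd 13 0 2 0 0 [], Fwd 13 0 2 0 0 [], Fwd 13 7 2 0 0 []], Bwd 2 5 0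
      3 1 [Bwd 2 5 0 7 1 [Bwd (-4) 1 10 3 1 [Bwd 5 5 0 3 1 [Bwd (-4) 6 3 4 1 [Bwd 3 9 0 1 2 [Bwd (-1) 5 3 4 1
      [Bwd 0 9 3 2 0 [Bwd 1 2 0 3 1 [Bwd (-1) 5 0 0 3 [Bwd 1 5 0 1 2 [Bwd 0 3 4 0 7 []]]]]]]]]]]]], Bwd (-9) 2
      0 3 1 [Fwd (-5) 3 1 5 3 [Fwd 13 0 2 0 0 [], Fwd 13 0 2 0 0 [], Fwd 13 0 2 0 0 [], Fwd 13 0 2 0 0 []]]]],
      Bwd (-12) 0 0 0 4 [], Bwd (-12) 0 0 0 4 [], Bwd (-12) 0 0 0 4 [], Bwd (-12) 0 0 0 4 [], Bwd (-12) 0 0 0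
      4 [], Bwd (-12) 0 0 0 4 [], Fwd (-12) 0 0 3 0 [], Fwd (-12) 0 0 0 2 [], Fwd (-12) 0 0 0 2 [], Fwd (-12)
      0 0 0 2 [], Fwd (-12) 0 0 0 4 [], Fwd (-12) 0 0 0 4 [], Fwd (-12) 0 0 0 4 [], Fwd (-12) 0 0 0 4 [], Fwd
      (-12) 0 0 0 4 [], Fwd (-12) 0 0 0 4 [], Fwd (-12) 0 0 0 4 [], Fwd (-12) 0 0 0 4 [], Fwd (-12) 0 0 0 4
      [], Fwd (-12) 0 0 0 4 []]"
  "check_roots 12 (walls 12) (- 12)
     [Fwd 13 0 4 0 0 [], Fwd 13 0 4 0 0 [], Fwd 13 0 4 0 0 [], Fwd 13 0 4 0 0 [], Fwd 13 0 4 0 0 [], Fwd 13 0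
      4 0 0 [], Fwd 13 0 4 0 0 [], Fwd 13 0 4 0 0 [], Fwd 13 0 4 0 0 [], Fwd 13 0 4 0 0 [], Fwd 13 0 2 0 0 [],
      Fwd 13 0 2 0 0 [], Fwd 13 0 2 0 0 [], Fwd 13 3 0 0 0 [], Bwd 13 0 4 0 0 [], Bwd 13 0 4 0 0 [], Bwd 13 0
      4 0 0 [], Bwd 13 0 4 0 0 [], Bwd 13 0 4 0 0 [], Bwd 13 0 4 0 0 [], Bwd 13 0 4 0 0 [], Bwd 12 0 4 0 0
      [Bwd (-11) 0 2 2 1 [Fwd 3 2 0 0 5 [Fwd (-12) 0 0 1 2 []], Bwd 7 2 0 1 2 [Bwd (-3) 2 0 4 2 [], Bwd (-6) 3
      1 4 1 [Bwd 5 5 0 2 0 []]], Bwd 5 4 0 3 1 [Bwd (-1) 2 0 6 2 [Bwd (-2) 2 0 4 2 [Bwd 4 2 0 4 2 [Bwd (-4) 6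
      0 4 1 [Bwd 4 6 13 1 2 []]]]]]]], Bwd 11 0 4 0 0 [Bwd (-8) 6 0 2 1 [Bwd 5 2 0 1 2 [Bwd (-2) 2 0 4 1 [Bwd
      0 5 0 1 2 [Bwd 2 5 0 4 1 [Bwd (-2) 10 4 3 1 []]]]], Fwd (-4) 1 4 8 1 [Fwd (-5) 0 3 3 6 [Fwd 13 0 2 0 0
      []]]], Bwd (-11) 0 2 2 1 [Bwd 10 2 0 2 0 [Bwd (-9) 0 4 4 1 [Bwd 9 5 0 2 0 []]], Bwd 7 2 0 1 2 [Bwd (-3)
      2 0 6 1 [Bwd 0 8 0 3 1 [Bwd 3 6 3 0 10 []]], Bwd (-5) 5 3 4 1 [Bwd 3 6 3 2 0 [Bwd (-1) 3 1 3 1 [Bwd 0 5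
      0 2 0 [Bwd 1 2 0 7 1 [Bwd (-1) 9 0 0 3 [Bwd 1 5 0 1 2 [Bwd 0 3 4 0 7 []]]]]]]]]]], Bwd 10 0 4 0 0 [Fwd
      (-6) 0 2 6 0 [Fwd (-3) 0 2 1 4 [Fwd 13 0 2 0 0 [], Fwd 13 6 10 0 0 []]], Bwd (-9) 3 0 2 1 [Bwd 7 2 0 1 2
      [Bwd (-5) 3 1 4 2 [Bwd 4 5 0 2 0 []]], Bwd 5 4 0 1 2 [Bwd (-2) 2 0 6 1 [Bwd 0 5 0 1 2 [Bwd 2 5 0 4 1
      [Bwd (-3) 6 3 3 1 [Bwd 4 5 0 1 2 [Fwd (-7) 13 8 7 1 [Fwd 1 3 15 1 10 [Fwd 8 18 12 1 14 [Fwd (-12) 0 0 1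
      3 []]]]]]]]]]], Bwd (-11) 0 2 2 1 [Bwd 10 2 0 2 0 [Bwd (-9) 0 4 4 2 [Bwd 9 5 0 2 0 [], Bwd 6 6 0 1 2
      [Bwd (-4) 3 1 10 2 [Bwd 3 5 0 2 0 []]]]], Bwd 8 4 3 1 2 [Bwd (-5) 5 3 4 1 [Bwd 3 8 3 2 0 [Bwd (-1) 3 1 3
      1 [Bwd 0 5 0 2 0 [Bwd 1 2 0 7 1 [Bwd (-1) 9 0 0 3 [Bwd 1 5 0 1 2 [Bwd 0 3 4 0 7 []]]]]]]]]]], Bwd 10 0 4
      3 0 [Bwd (-7) 3 0 2 1 [Bwd 4 2 0 1 2 [Bwd (-1) 2 0 4 2 [Bwd (-1) 5 0 3 1 [Bwd 3 6 0 8 6 []]]], Bwd 2 4 0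
      3 1 [Bwd 2 5 0 6 1 [Bwd (-4) 1 8 3 1 [Bwd 5 5 0 3 1 [Bwd (-4) 6 3 4 1 [Fwd (-8) 1 5 13 7 [Bwd 3 7 0 1 2
      [Bwd (-1) 2 5 3 1 [Bwd 0 11 3 2 0 [Bwd 1 2 0 3 1 [Bwd (-1) 5 0 0 3 [Bwd 1 5 0 1 2 [Bwd 0 3 4 0 7
      []]]]]]]]]]]]]], Bwd (-9) 3 0 2 1 [Bwd 7 2 0 1 2 [Bwd (-5) 3 1 4 2 [Bwd 4 5 0 2 0 [], Fwd (-10) 1 8 4 1
      [Fwd 6 0 3 3 10 [Fwd 1 0 12 2 5 [Fwd (-10) 0 7 14 0 [Fwd 13 0 2 0 0 []]]]]]], Fwd (-9) 1 4 3 1 [Fwd 4 5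
      3 1 6 [Fwd 4 0 8 1 5 [Fwd (-12) 0 0 1 9 []]]]]]]"
  by code_simp+

section \<open>Analytic bounds for cycles\<close>

lemma periodic_attains_max:
  fixes N :: "int \<Rightarrow> 'a :: linorder"
  assumes "0 < p" "\<And>i. N (i + p) = N i"
  obtains k where "\<And>i. N i \<le> N k"
proof -
  have shift: "N (j + k * p) = N j" for j k
  proof (induction k rule: int_induct[of _ 0])
    case (step1 k)
    then show ?case using assms(2)[of "j + k * p"] by (simp add: algebra_simps)
  next
    case (step2 k)
    then show ?case using assms(2)[of "j + (k - 1) * p"] by (simp add: algebra_simps)
  qed simp
  have mod: "N j = N (j mod p)" for j
    using shift[of "j mod p" "j div p"] by simp
  define S where "S = N ` {0..<p}"
  have S: "finite S" "N j \<in> S" for j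
    using assms(1) by (auto simp: S_def mod[of j])
  have "Max S \<in> S" using S by (intro Max_in) auto
  then obtain k where "N k = Max S" by (auto simp: S_def)
  then show ?thesis using that[of k] S by simp
qed

text \<open>At an index \<open>k\<close> where \<open>N\<close> is maximal,
  \<open>t * N k \<le> N (k + 1) + F \<le> N k + F\<close>.\<close>

lemma expanding_bound:
  fixes N :: "int \<Rightarrow> real"
  assumes "0 < p" "\<And>i. N (i + p) = N i" "1 < t" "\<And>i. t * N i \<le> N (i + 1) + F"
  shows "(t - 1) * N i \<le> F"
proof -
  obtain k where k: "\<And>i. N i \<le> N k" using periodic_attains_max[of p N] assms(1,2) by auto
  have "(t - 1) * N i \<le> (t - 1) * N k" using k assms(3) by (intro mult_left_mono) auto
  also have "\<dots> \<le> F" using assms(4)[of k] k[of "k + 1"] by (simp add: algebra_simps)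
  finally show ?thesis .
qed

text \<open>The fixed point of the recursion with constant remainder \<open>1/2\<close>.\<close>

definition centre :: "real \<Rightarrow> real \<Rightarrow> real" where
  "centre x y = 1 / (2 * (1 + x + y))"

text \<open>Centring moves the remainder from \<open>[0, 1)\<close> to an interval symmetric about
  0, which halves the error in all later bounds.\<close>

lemma centred_recursion:
  assumes "srs_cycle x y a" "0 < 1 + x + y"
  defines "g \<equiv> \<lambda>i. a i - centre x y"
  shows "\<bar>x * g i + y * g (i + 1) + g (i + 2)\<bar> \<le> 1 / 2"
proof -
  have "(1 + x + y) * centre x y = 1 / 2" using assms(2) by (simp add: centre_def)
  then have "x * g i + y * g (i + 1) + g (i + 2) = a i * x + a (i + 1) * y + a (i + 2) - 1 / 2"
    by (simp add: g_def algebra_simps)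
  then show ?thesis using srs_cycle_bounds(1,2)[OF assms(1), of i] by (simp add: abs_if)
qed

text \<open>
  The form \<open>x b\<^sup>2 + y b c + c\<^sup>2\<close> is multiplied by exactly \<open>x\<close> under \<open>(b, c) \<mapsto> (c, - x b - y c)\<close>, and the
  remainder acts along a vector of norm 1.
\<close>

lemma sqrt_form_ge:
  fixes x y b w f :: real
  assumes "y\<^sup>2 \<le> 4 * x"
  shows "sqrt (x * b\<^sup>2 + y * b * w + w\<^sup>2) \<le> sqrt (x * b\<^sup>2 + y * b * (w + f) + (w + f)\<^sup>2) + \<bar>f\<bar>"
proof -
  define q where "q = x * b\<^sup>2 + y * b * w + w\<^sup>2"
  define q' where "q' = x * b\<^sup>2 + y * b * (w + f) + (w + f)\<^sup>2"
  have form: "(2 * c + y * b)\<^sup>2 \<le> 4 * (x * b\<^sup>2 + y * b * c + c\<^sup>2)" for c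
  proof -
    have "y\<^sup>2 * b\<^sup>2 \<le> (4 * x) * b\<^sup>2" using assms by (intro mult_right_mono) auto
    then show ?thesis by (simp add: power2_eq_square algebra_simps)
  qed
  have "0 \<le> x * b\<^sup>2 + y * b * c + c\<^sup>2" for c
    using order_trans[OF zero_le_power2 form, of c] by simp
  then have q: "0 \<le> q" and q': "0 \<le> q'" by (simp_all add: q_def q'_def)
  \<comment> \<open>In the inner product of the form, \<open>2 * w + y * b\<close> is twice the
    product of \<open>(b, w)\<close> with the unit vector \<open>(0, 1)\<close>. So this is the
    Cauchy-Schwarz inequality, and the remaining steps are the reverse triangle inequality in
    squared form.\<close>
  have "(2 * w + y * b)\<^sup>2 \<le> (2 * sqrt q)\<^sup>2"
    using form[of w] q by (simp add: q_def[symmetric] power_mult_distrib)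
  then have "\<bar>2 * w + y * b\<bar> \<le> 2 * sqrt q"
    using q abs_le_square_iff[of "2 * w + y * b" "2 * sqrt q"] by simp
  then have "\<bar>f\<bar> * \<bar>2 * w + y * b\<bar> \<le> \<bar>f\<bar> * (2 * sqrt q)" by (intro mult_left_mono) auto
  then have fw: "- (f * (2 * w + y * b)) \<le> \<bar>f\<bar> * (2 * sqrt q)"
    using order_trans[OF abs_ge_minus_self[of "f * (2 * w + y * b)"]] by (simp only: abs_mult)
  have "(sqrt q - \<bar>f\<bar>)\<^sup>2 = q - \<bar>f\<bar> * (2 * sqrt q) + f\<^sup>2"
    using q by (simp add: power2_diff)
  also have "\<dots> \<le> q + f * (2 * w + y * b) + f\<^sup>2" using fw by simp
  also have "\<dots> = q'" by (simp add: q_def q'_def power2_eq_square algebra_simps)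
  finally have "(sqrt q - \<bar>f\<bar>)\<^sup>2 \<le> q'" .
  then have "sqrt q - \<bar>f\<bar> \<le> sqrt q'" by (rule real_le_rsqrt)
  then show ?thesis by (simp add: q_def q'_def)
qed

text \<open>The norm \<open>sqrt (Q i)\<close> is expanded by the factor \<open>sqrt x\<close> up to
  an error of \<open>1/2\<close>, so \<open>expanding_bound\<close> gives
  \<open>(sqrt x - 1) * sqrt (Q i) \<le> 1/2\<close>. Completing the square yields
  \<open>(x - y\<^sup>2 / 4) * (g i)\<^sup>2 \<le> Q i\<close>.\<close>

lemma cycle_bound_elliptic:
  assumes "srs_cycle x y a" "0 < 1 + x + y" "1 < x" "y\<^sup>2 \<le> 4 * x"
  shows "(a i - centre x y)\<^sup>2 * (x - y\<^sup>2 / 4) * (sqrt x - 1)\<^sup>2 \<le> 1 / 4"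
proof -
  define g where "g = (\<lambda>i. a i - centre x y)"
  define Q where "Q = (\<lambda>i. x * (g i)\<^sup>2 + y * g i * g (i + 1) + (g (i + 1))\<^sup>2)"
  define f where "f = (\<lambda>i. x * g i + y * g (i + 1) + g (i + 2))"
  obtain p where p: "0 < p" "\<And>i. a (i + p) = a i" using assms(1) by (auto simp: srs_cycle_def)
  have gp: "g (i + p) = g i" for i by (simp add: g_def p)
  have Qp: "Q (i + p) = Q i" for i
    using gp[of i] gp[of "i + 1"] by (simp add: Q_def ac_simps)
  have step: "sqrt x * sqrt (Q i) \<le> sqrt (Q (i + 1)) + 1 / 2" for i
  proof -
    \<comment> \<open>The next centred entry without its remainder; on \<open>(g (i + 1), w)\<close>
      the form takes the value \<open>x * Q i\<close> exactly.\<close>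
    define w where "w = - x * g i - y * g (i + 1)"
    have "x * Q i = x * (g (i + 1))\<^sup>2 + y * g (i + 1) * w + w\<^sup>2"
      by (simp add: Q_def w_def power2_eq_square algebra_simps)
    moreover have "Q (i + 1) = x * (g (i + 1))\<^sup>2 + y * g (i + 1) * (w + f i) + (w + f i)\<^sup>2"
      by (simp add: Q_def w_def f_def add.assoc)
    moreover have "\<bar>f i\<bar> \<le> 1 / 2"
      using centred_recursion[OF assms(1,2)] by (simp add: f_def g_def)
    ultimately have "sqrt (x * Q i) \<le> sqrt (Q (i + 1)) + \<bar>f i\<bar>" "\<bar>f i\<bar> \<le> 1 / 2"
      using sqrt_form_ge[OF assms(4), of "g (i + 1)" w "f i"] by (simp_all only:)
    then have "sqrt (x * Q i) \<le> sqrt (Q (i + 1)) + 1 / 2" by linarith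
    then show ?thesis by (simp add: real_sqrt_mult)
  qed
  have le: "(x - y\<^sup>2 / 4) * (g i)\<^sup>2 \<le> Q i"
  proof -
    have "Q i = (x - y\<^sup>2 / 4) * (g i)\<^sup>2 + (y * g i / 2 + g (i + 1))\<^sup>2"
      by (simp add: Q_def power2_eq_square algebra_simps)
    then show ?thesis by simp
  qed
  moreover have "0 \<le> (x - y\<^sup>2 / 4) * (g i)\<^sup>2" using assms(4) by simp
  ultimately have Q0: "0 \<le> Q i" by linarith
  have "(sqrt x - 1) * sqrt (Q i) \<le> 1 / 2"
    using expanding_bound[of p "\<lambda>i. sqrt (Q i)" "sqrt x" "1 / 2" i] p Qp step assms(3) by simp
  then have "((sqrt x - 1) * sqrt (Q i))\<^sup>2 \<le> (1 / 2)\<^sup>2"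
    using assms(3) Q0 by (intro power_mono) auto
  then have "(sqrt x - 1)\<^sup>2 * Q i \<le> 1 / 4" using Q0 by (simp add: power_mult_distrib power_divide)
  moreover have "(sqrt x - 1)\<^sup>2 * ((x - y\<^sup>2 / 4) * (g i)\<^sup>2) \<le> (sqrt x - 1)\<^sup>2 * Q i"
    using le by (intro mult_left_mono) auto
  ultimately show ?thesis by (simp add: g_def mult.commute mult.left_commute)
qed

text \<open>The characteristic polynomial \<open>X\<^sup>2 + y X + x\<close> is
  \<open>(X + s) (X + t) + r\<close> with \<open>r = x - s * t\<close>. Expansion by
  \<open>t\<close> bounds \<open>c i = s * g i + g (i + 1)\<close>, then expansion by
  \<open>s\<close> bounds \<open>g i\<close>. The defect \<open>r\<close> allows a double root
  \<open>s = t\<close> in place of slightly non-real ones.\<close>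

lemma cycle_bound_factored:
  assumes "srs_cycle x y a" "0 < 1 + x + y" "1 < s" "1 < t" "s + t = y" "0 \<le> x - s * t"
  shows "\<bar>a i - centre x y\<bar> * ((s - 1) * (t - 1) - (x - s * t)) \<le> 1 / 2"
proof -
  define g where "g = (\<lambda>i. a i - centre x y)"
  define r where "r = x - s * t"
  define c where "c = (\<lambda>i. s * g i + g (i + 1))"
  obtain p where p: "0 < p" "\<And>i. a (i + p) = a i" using assms(1) by (auto simp: srs_cycle_def)
  have gp: "g (i + p) = g i" for i by (simp add: g_def p)
  have cp: "c (i + p) = c i" for i
    using gp[of i] gp[of "i + 1"] by (simp add: c_def ac_simps)
  \<comment> \<open>With \<open>k\<close> maximising \<open>\<bar>g i\<bar>\<close>, the defect
    contributes at most \<open>r * \<bar>g k\<bar>\<close> everywhere; this multiple of the quantity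
    to be bounded is absorbed at the end.\<close>
  obtain k where k: "\<And>i. \<bar>g i\<bar> \<le> \<bar>g k\<bar>" using periodic_attains_max[of p "\<lambda>i. \<bar>g i\<bar>"] p gp by auto
  have ck: "(t - 1) * \<bar>c i\<bar> \<le> 1 / 2 + r * \<bar>g k\<bar>" for i
  proof (rule expanding_bound[OF p(1)])
    fix i
    have "c (i + 1) + t * c i = (x * g i + y * g (i + 1) + g (i + 2)) - r * g i"
      by (simp add: c_def r_def assms(5)[symmetric] algebra_simps)
    moreover have "\<bar>x * g i + y * g (i + 1) + g (i + 2)\<bar> \<le> 1 / 2"
      using centred_recursion[OF assms(1,2)] by (simp add: g_def)
    moreover have "\<bar>r * g i\<bar> \<le> r * \<bar>g k\<bar>"
      using k[of i] assms(6) by (simp add: abs_mult r_def mult_left_mono)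
    moreover have "t * \<bar>c i\<bar> = \<bar>t * c i\<bar>" using assms(4) by (simp add: abs_mult)
    ultimately show "t * \<bar>c i\<bar> \<le> \<bar>c (i + 1)\<bar> + (1 / 2 + r * \<bar>g k\<bar>)" by linarith
  qed (use cp assms(4) in auto)
  have "s * \<bar>g k\<bar> = \<bar>s * g k\<bar>" using assms(3) by (simp add: abs_mult)
  also have "\<dots> \<le> \<bar>c k\<bar> + \<bar>g (k + 1)\<bar>" by (simp add: c_def)
  finally have "(s - 1) * \<bar>g k\<bar> \<le> \<bar>c k\<bar>" using k[of "k + 1"] by (simp add: left_diff_distrib)
  then have "(t - 1) * ((s - 1) * \<bar>g k\<bar>) \<le> (t - 1) * \<bar>c k\<bar>"
    using assms(4) by (intro mult_left_mono) auto
  also note ck[of k]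
  finally have "(t - 1) * ((s - 1) * \<bar>g k\<bar>) \<le> 1 / 2 + r * \<bar>g k\<bar>" .
  then have *: "\<bar>g k\<bar> * ((s - 1) * (t - 1) - r) \<le> 1 / 2" by (simp add: algebra_simps)
  show ?thesis
  proof (cases "0 \<le> (s - 1) * (t - 1) - r")
    case True
    then have "\<bar>g i\<bar> * ((s - 1) * (t - 1) - r) \<le> \<bar>g k\<bar> * ((s - 1) * (t - 1) - r)"
      using k by (intro mult_right_mono)
    then show ?thesis using * by (simp add: g_def r_def)
  next
    case False
    then have "\<bar>g i\<bar> * ((s - 1) * (t - 1) - r) \<le> 0" by (simp add: mult_nonneg_nonpos)
    then show ?thesis by (simp add: g_def r_def)
  qed
qed

section \<open>Parameters near the line \<open>y = x + 1\<close>\<close>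

definition alternating_cycle :: "real \<Rightarrow> real \<Rightarrow> (int \<Rightarrow> int) \<Rightarrow> bool" where
  "alternating_cycle x d A \<longleftrightarrow>
     (\<exists>p>0. \<forall>i. A (i + p) = A i) \<and>
     (\<forall>i. let B = A i - A (i + 1); B' = A (i + 1) - A (i + 2) in
        if even i then B' = \<lfloor>x * B + d * A (i + 1)\<rfloor> else B' = \<lceil>x * B + d * A (i + 1)\<rceil>)"

lemma alternating_cycle_even:
  assumes "alternating_cycle x d A" "even i"
  shows "A (i + 1) - A (i + 2) = \<lfloor>x * (A i - A (i + 1)) + d * A (i + 1)\<rfloor>"
  using assms by (simp add: alternating_cycle_def Let_def)

lemma alternating_cycle_odd:
  assumes "alternating_cycle x d A" "odd i"
  shows "A (i + 1) - A (i + 2) = \<lceil>x * (A i - A (i + 1)) + d * A (i + 1)\<rceil>"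
  using assms by (simp add: alternating_cycle_def Let_def)

text \<open>Negation exchanges floor and ceiling, and the shift exchanges the parities again. By
  this symmetry an upper bound for all such cycles also gives a lower bound.\<close>

lemma alternating_cycle_shift:
  assumes "alternating_cycle x d A"
  shows "alternating_cycle x d (\<lambda>i. - A (i + 1))"
  unfolding alternating_cycle_def Let_def
proof (intro conjI allI)
  obtain p where p: "p > 0" "\<And>i. A (i + p) = A i" using assms by (auto simp: alternating_cycle_def)
  have "A (i + p + 1) = A (i + 1)" for i using p(2)[of "i + 1"] by (simp add: ac_simps)
  then show "\<exists>p>0. \<forall>i. - A (i + p + 1) = - A (i + 1)" using p(1) by auto
  fix i
  have i: "i + 1 + 1 = i + 2" "i + 2 + 1 = i + 3" "i + 1 + 2 = i + (3 :: int)" by simp_all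
  define v where "v = x * (A (i + 1) - A (i + 2)) + d * A (i + 2)"
  have v: "x * real_of_int (- A (i + 1) - - A (i + 2)) + d * real_of_int (- A (i + 2)) = - v"
    by (simp add: v_def algebra_simps)
  have "odd i \<Longrightarrow> A (i + 2) - A (i + 3) = \<lfloor>v\<rfloor>" "even i \<Longrightarrow> A (i + 2) - A (i + 3) = \<lceil>v\<rceil>"
    using alternating_cycle_even[OF assms, of "i + 1"] alternating_cycle_odd[OF assms, of "i + 1"]
    unfolding i by (simp_all add: v_def)
  then show "if even i
       then - A (i + 1 + 1) - - A (i + 2 + 1) =
         \<lfloor>x * real_of_int (- A (i + 1) - - A (i + 1 + 1)) + d * real_of_int (- A (i + 1 + 1))\<rfloor>
       else - A (i + 1 + 1) - - A (i + 2 + 1) =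
         \<lceil>x * real_of_int (- A (i + 1) - - A (i + 1 + 1)) + d * real_of_int (- A (i + 1 + 1))\<rceil>"
    unfolding i v floor_minus ceiling_minus by auto
qed

text \<open>The floor loses less than 1 and the ceiling loses nothing. A negative \<open>k\<close>
  expresses that \<open>A (i + 1)\<close> is positive.\<close>

lemma alternating_cycle_steps:
  assumes "alternating_cycle x d A" "4 / 3 \<le> x" "0 < d" "0 \<le> b" "b \<le> A i - A (i + 1)" "- k \<le> A (i + 1)"
  shows "even i \<Longrightarrow> 4 / 3 * b - k * d < A (i + 1) - A (i + 2) + 1"
    and "odd i \<Longrightarrow> 4 / 3 * b - k * d \<le> A (i + 1) - A (i + 2)"
proof -
  define v where "v = x * (A i - A (i + 1)) + d * A (i + 1)"
  have "4 / 3 * real_of_int b \<le> x * (A i - A (i + 1))"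
    using assms by (intro mult_mono) auto
  moreover have "d * - k \<le> d * A (i + 1)" using assms(3,6) by (intro mult_left_mono) linarith+
  ultimately have v: "4 / 3 * b - k * d \<le> v" by (simp add: v_def mult.commute)
  show "4 / 3 * b - k * d < A (i + 1) - A (i + 2) + 1" if "even i"
  proof -
    have "A (i + 1) - A (i + 2) = \<lfloor>v\<rfloor>"
      using alternating_cycle_even[OF assms(1) that] by (simp add: v_def)
    then have "real_of_int (A (i + 1)) - A (i + 2) = \<lfloor>v\<rfloor>" by (metis of_int_diff)
    then show ?thesis using v real_of_int_floor_add_one_gt[of v] by linarith
  qed
  show "4 / 3 * b - k * d \<le> A (i + 1) - A (i + 2)" if "odd i"
  proof -
    have "A (i + 1) - A (i + 2) = \<lceil>v\<rceil>"
      using alternating_cycle_odd[OF assms(1) that] by (simp add: v_def)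
    then have "real_of_int (A (i + 1)) - A (i + 2) = \<lceil>v\<rceil>" by (metis of_int_diff)
    then show ?thesis using v le_of_int_ceiling[of v] by linarith
  qed
qed

text \<open>A descent of at least 4 reproduces itself, as \<open>4 * x - 4 * (x - 1) = 4\<close>.
  Then \<open>A\<close> would fall by at least 4 in every step, against periodicity.\<close>

lemma alternating_cycle_descent_le:
  assumes "alternating_cycle x d A" "4 / 3 \<le> x" "\<And>i. \<bar>d * A i\<bar> \<le> 4 * (x - 1)"
  shows "A i - A (i + 1) \<le> 3"
proof (rule ccontr)
  assume "\<not> ?thesis"
  then have start: "4 \<le> A i - A (i + 1)" by simp
  have step: "4 \<le> A (j + 1) - A (j + 2)" if "4 \<le> A j - A (j + 1)" for j
  proof -
    define v where "v = x * (A j - A (j + 1)) + d * A (j + 1)"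
    have "x * 4 \<le> x * (A j - A (j + 1))" using that assms(2) by (intro mult_left_mono) auto
    moreover have "- (d * A (j + 1)) \<le> 4 * (x - 1)" using assms(3) by (rule abs_le_D2)
    ultimately have v: "4 \<le> v" by (simp add: v_def algebra_simps)
    have "A (j + 1) - A (j + 2) = \<lfloor>v\<rfloor> \<or> A (j + 1) - A (j + 2) = \<lceil>v\<rceil>"
      using alternating_cycle_even[OF assms(1), of j] alternating_cycle_odd[OF assms(1), of j]
      by (cases "even j") (simp_all add: v_def)
    moreover have "4 \<le> \<lfloor>v\<rfloor>" using v by (simp add: le_floor_iff)
    ultimately show ?thesis using floor_le_ceiling[of v] by linarith
  qed
  have *: "4 \<le> A (i + int n) - A (i + int n + 1) \<and> A (i + int n) \<le> A i - 4 * int n" for n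
  proof (induction n)
    case (Suc n)
    then show ?case using step[of "i + int n"] by (simp add: ac_simps)
  qed (use start in simp)
  obtain p where p: "p > 0" "\<And>i. A (i + p) = A i" using assms(1) by (auto simp: alternating_cycle_def)
  show False using *[of "nat p"] p(1) p(2)[of i] by simp
qed

text \<open>Suppose \<open>B = A i - A (i + 1) \<ge> 0\<close>. At odd indices the ceiling raises
  \<open>B\<close> by at least 1, and at even indices the floor does not lower it. In the slowest
  run \<open>B\<close> is 0, 0, 1, 1, 2, 2, 3, 3 while the position reached is at least 1, 1, 0, -1,
  -3, -5, -8, -11. From there the ceiling gives \<open>B \<ge> 4\<close>, because
  \<open>4 - 11 * d > 3\<close>; this is the source of the threshold \<open>1/11\<close>.\<close>

lemma alternating_cycle_no_descent:
  assumes cyc: "alternating_cycle x d A" and x: "4 / 3 \<le> x" and d: "0 < d" "d < 1 / 11"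
    and bd: "\<And>i. \<bar>d * A i\<bar> \<le> 4 * (x - 1)"
    and pos: "0 < A (i + 1)"
  shows "A i < A (i + 1)"
proof -
  define B where "B = (\<lambda>i. A i - A (i + 1))"
  have le3: "B j \<le> 3" for j
    using alternating_cycle_descent_le[OF cyc x bd] by (simp add: B_def)
  have A: "A (j + 1 + 1) = A (j + 1) - B (j + 1)" for j by (simp add: B_def)
  have even: "even j \<Longrightarrow> 0 \<le> b \<Longrightarrow> b \<le> B j \<Longrightarrow> - k \<le> A (j + 1) \<Longrightarrow> 4 / 3 * b - k * d < B (j + 1) + 1"
   and odd: "odd j \<Longrightarrow> 0 \<le> b \<Longrightarrow> b \<le> B j \<Longrightarrow> - k \<le> A (j + 1) \<Longrightarrow> 4 / 3 * b - k * d \<le> B (j + 1)" for b k j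
    using alternating_cycle_steps[OF cyc x d(1), of b j k] by (simp_all add: B_def add.assoc)
  \<comment> \<open>Each case bounds the position \<open>A\<close> from below, using that it drops by at most \<open>B \<le> 3\<close> per step.\<close>
  have odd3: False if "odd j" "3 \<le> B j" "- 11 \<le> A (j + 1)" for j
    using odd[of j 3 11] that le3[of "j + 1"] d by simp
  have even3: False if "even j" "3 \<le> B j" "- 8 \<le> A (j + 1)" for j
    using even[of j 3 8] that le3[of "j + 1"] d odd3[of "j + 1"] A[of j] by simp
  have odd2: False if "odd j" "2 \<le> B j" "- 5 \<le> A (j + 1)" for j
    using odd[of j 2 5] that le3[of "j + 1"] d even3[of "j + 1"] A[of j] by simp
  have even2: False if "even j" "2 \<le> B j" "- 3 \<le> A (j + 1)" for j
    using even[of j 2 3] that le3[of "j + 1"] d odd3[of "j + 1"] odd2[of "j + 1"] A[of j]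
    by (cases "B (j + 1) \<le> 2") simp_all
  have odd1: False if "odd j" "1 \<le> B j" "- 1 \<le> A (j + 1)" for j
    using odd[of j 1 1] that le3[of "j + 1"] d even3[of "j + 1"] even2[of "j + 1"] A[of j]
    by (cases "B (j + 1) \<le> 2") simp_all
  have even1: False if "even j" "1 \<le> B j" "0 \<le> A (j + 1)" for j
    using even[of j 1 0] that le3[of "j + 1"] d odd3[of "j + 1"] odd2[of "j + 1"] odd1[of "j + 1"] A[of j]
    by (cases "B (j + 1) \<le> 2"; cases "B (j + 1) \<le> 1") simp_all
  have odd0: False if "odd j" "0 \<le> B j" "1 \<le> A (j + 1)" for j
    using odd[of j 0 "- 1"] that le3[of "j + 1"] d even3[of "j + 1"] even2[of "j + 1"] even1[of "j + 1"] A[of j]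
    by (cases "B (j + 1) \<le> 2"; cases "B (j + 1) \<le> 1") simp_all
  have even0: False if "even j" "0 \<le> B j" "1 \<le> A (j + 1)" for j
    using even[of j 0 "- 1"] that le3[of "j + 1"] d odd3[of "j + 1"] odd2[of "j + 1"] odd1[of "j + 1"]
      odd0[of "j + 1"] A[of j]
    by (cases "B (j + 1) \<le> 2"; cases "B (j + 1) \<le> 1"; cases "B (j + 1) \<le> 0") simp_all
  show ?thesis using odd0[of i] even0[of i] pos by (cases "even i") (force simp: B_def)+
qed

text \<open>At a positive maximum \<open>A k\<close> the step before is a strict ascent, and
  \<open>A (k + 1) \<le> 0\<close> since otherwise \<open>A\<close> would ascend beyond its maximum.
  The descent after \<open>k\<close> is thus at least \<open>A k\<close>, but the recursion makes it
  less than \<open>- x + d * A k + 1 < A k\<close>.\<close>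

lemma alternating_cycle_nonpos:
  assumes cyc: "alternating_cycle x d A" and x: "4 / 3 \<le> x" and d: "0 < d" "d < 1 / 11"
    and bd: "\<And>i. \<bar>d * A i\<bar> \<le> 4 * (x - 1)"
  shows "A i \<le> 0"
proof (rule ccontr)
  assume "\<not> A i \<le> 0"
  obtain p where p: "p > 0" "\<And>i. A (i + p) = A i" using cyc by (auto simp: alternating_cycle_def)
  obtain k where max: "\<And>j. A j \<le> A k" using periodic_attains_max[of p A] p by auto
  have k1: "k - 1 + 1 = k" "k - 1 + 2 = k + 1" by simp_all
  have pos: "1 \<le> A k" using max[of i] \<open>\<not> A i \<le> 0\<close> by linarith
  have before: "A (k - 1) - A k \<le> - 1"
    using alternating_cycle_no_descent[OF cyc x d bd, of "k - 1"] pos by simp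
  have "A (k + 1) \<le> 0"
    using alternating_cycle_no_descent[OF cyc x d bd, of k] max[of "k + 1"] by linarith
  then have "real_of_int (A k) \<le> A k - A (k + 1)" by simp
  also have "A k - A (k + 1) < x * (A (k - 1) - A k) + d * A k + 1"
    using alternating_cycle_even[OF cyc, of "k - 1"] alternating_cycle_odd[OF cyc, of "k - 1"]
    unfolding k1 by (cases "even (k - 1)") linarith+
  finally have "real_of_int (A k) < x * (A (k - 1) - A k) + d * A k + 1" by simp
  moreover have "x * (A (k - 1) - A k) \<le> x * - 1"
    using before x by (intro mult_left_mono) linarith+
  moreover have "d * A k \<le> 1 * real_of_int (A k)" using d pos by (intro mult_right_mono) auto
  ultimately show False using x by linarith
qed

lemma cycle_zero_near_line:
  assumes cyc: "srs_cycle x y a" and x: "4 / 3 \<le> x" and y: "y < x + 1" "x + 1 < y + 1 / 11"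
    and bd: "\<And>i. (x + 1 - y) * \<bar>a i\<bar> \<le> 4 * (x - 1)"
  shows "a i = 0"
proof -
  define d where "d = x + 1 - y"
  define A where "A = (\<lambda>i. if even i then a i else - a i)"
  have d: "0 < d" "d < 1 / 11" using y by (auto simp: d_def)
  have alt: "alternating_cycle x d A"
    unfolding alternating_cycle_def Let_def
  proof (intro conjI allI)
    obtain p where p: "p > 0" "\<And>i. a (i + p) = a i" using cyc by (auto simp: srs_cycle_def)
    \<comment> \<open>The period is doubled because \<open>p\<close> may be odd and the sign depends
      on the parity.\<close>
    have "A (i + 2 * p) = A i" for i
      using p(2)[of i] p(2)[of "i + p"] by (simp add: A_def add.assoc)
    then show "\<exists>p>0. \<forall>i. A (i + p) = A i" using p(1) by (intro exI[of _ "2 * p"]) auto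
    fix i
    have "x * (a i + a (i + 1)) - d * a (i + 1) =
        a i * x + a (i + 1) * y + a (i + 2) - (a (i + 1) + a (i + 2))"
      by (simp add: d_def algebra_simps)
    then have e: "- (a (i + 1) + a (i + 2)) \<le> x * (a i + a (i + 1)) - d * a (i + 1)"
        "x * (a i + a (i + 1)) - d * a (i + 1) < 1 - (a (i + 1) + a (i + 2))"
      using srs_cycle_bounds(1,2)[OF cyc, of i] by simp_all
    show "if even i then A (i + 1) - A (i + 2) = \<lfloor>x * real_of_int (A i - A (i + 1)) + d * A (i + 1)\<rfloor>
       else A (i + 1) - A (i + 2) = \<lceil>x * real_of_int (A i - A (i + 1)) + d * A (i + 1)\<rceil>"
    proof (cases "even i")
      case True
      then show ?thesis using e by (simp add: A_def eq_commute[of _ "floor _"] floor_eq_iff)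
    next
      case False
      then show ?thesis using e by (simp add: A_def eq_commute[of _ "ceiling _"] ceiling_eq_iff algebra_simps)
    qed
  qed
  have bdA: "\<bar>d * A j\<bar> \<le> 4 * (x - 1)" for j
    using bd[of j] d(1) by (simp add: A_def abs_mult d_def[symmetric])
  have "A i \<le> 0" by (rule alternating_cycle_nonpos[OF alt x d bdA])
  \<comment> \<open>The shifted and negated cycle gives \<open>0 \<le> A i\<close>.\<close>
  moreover have "- A (i - 1 + 1) \<le> 0"
    by (rule alternating_cycle_nonpos[OF alternating_cycle_shift[OF alt] x d])
      (use bdA in simp)
  ultimately have "A i = 0" by simp
  then show ?thesis by (simp add: A_def split: if_splits)
qed

section \<open>Numerical bounds\<close>

text \<open>For real roots the exact factorisation has no defect and
  \<open>(s - 1) * (t - 1) = x + 1 - y\<close>. For slightly non-real roots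
  \<open>s = t = y / 2\<close> is used, and the factor becomes
  \<open>(x + 1 - y) - 2 * (x - y\<^sup>2 / 4)\<close>, at least half of
  \<open>x + 1 - y\<close>.\<close>

lemma cycle_bound_hyperbolic:
  assumes "srs_cycle x y a" "2 < y" "y < x + 1" "x - y\<^sup>2 / 4 \<le> (x + 1 - y) / 4"
  shows "\<bar>a i - centre x y\<bar> * (x + 1 - y) \<le> 1"
proof (cases "0 \<le> x - y\<^sup>2 / 4")
  case True
  have "\<bar>a i - centre x y\<bar> * ((y / 2 - 1) * (y / 2 - 1) - (x - y / 2 * (y / 2))) \<le> 1 / 2"
    using assms True by (intro cycle_bound_factored) (auto simp: power2_eq_square)
  moreover have "(x + 1 - y) / 2 \<le> (y / 2 - 1) * (y / 2 - 1) - (x - y / 2 * (y / 2))"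
    using assms(4) by (simp add: power2_eq_square field_simps)
  then have "\<bar>a i - centre x y\<bar> * ((x + 1 - y) / 2) \<le>
      \<bar>a i - centre x y\<bar> * ((y / 2 - 1) * (y / 2 - 1) - (x - y / 2 * (y / 2)))"
    by (intro mult_left_mono) auto
  ultimately show ?thesis by (simp add: field_simps)
next
  case False
  define r where "r = sqrt (y\<^sup>2 / 4 - x)"
  have r: "0 \<le> r" "r\<^sup>2 = y\<^sup>2 / 4 - x" using False by (auto simp: r_def)
  have "y\<^sup>2 / 4 - x < (y / 2 - 1)\<^sup>2"
    using assms(3) by (simp add: power2_eq_square field_simps)
  then have "r < y / 2 - 1"
    using assms(2) by (auto simp: r_def intro!: real_less_lsqrt)
  moreover have st: "(y / 2 - r) * (y / 2 + r) = x"
    using r(2) by (simp add: power2_eq_square field_simps)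
  ultimately have "\<bar>a i - centre x y\<bar> * ((y / 2 - r - 1) * (y / 2 + r - 1) - (x - (y / 2 - r) * (y / 2 + r))) \<le> 1 / 2"
    using assms r(1) by (intro cycle_bound_factored) auto
  moreover have "(y / 2 - r - 1) * (y / 2 + r - 1) = x + 1 - y"
    using st by (simp add: field_simps)
  ultimately show ?thesis using st by simp
qed

lemma cycle_bound_elliptic_le:
  assumes "srs_cycle x y a" "0 < 1 + x + y" "1 < x" "0 < x - y\<^sup>2 / 4" "0 \<le> c"
    and "1 \<le> 4 * c\<^sup>2 * ((x - y\<^sup>2 / 4) * (sqrt x - 1)\<^sup>2)"
  shows "\<bar>a i - centre x y\<bar> \<le> c"
proof -
  define v where "v = (x - y\<^sup>2 / 4) * (sqrt x - 1)\<^sup>2"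
  have v: "0 < v" using assms(3,4) by (simp add: v_def)
  have "(a i - centre x y)\<^sup>2 * v \<le> 1 / 4"
    using cycle_bound_elliptic[OF assms(1-3), of i] assms(4) by (simp add: v_def mult.assoc)
  also have "\<dots> \<le> c\<^sup>2 * v" using assms(6) by (simp add: v_def mult.assoc)
  finally have "(a i - centre x y)\<^sup>2 \<le> c\<^sup>2" using v by simp
  then show ?thesis using assms(5) by (metis abs_le_square_iff abs_of_nonneg)
qed

lemma sqrt_diff_one_ge:
  assumes "0 \<le> w" "(1 + w)\<^sup>2 \<le> x"
  shows "w\<^sup>2 \<le> (sqrt x - 1)\<^sup>2"
  using assms real_le_rsqrt[OF assms(2)] by (intro power_mono) auto

text \<open>Here \<open>w\<close> is a lower bound for \<open>sqrt x - 1\<close> and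
  \<open>r\<close> one for \<open>x - y\<^sup>2 / 4\<close>; with rational values the numerical
  check is free of square roots.\<close>

lemma cycle_bound_elliptic_product:
  assumes "srs_cycle x y a" "0 < 1 + x + y" "1 < x" "0 \<le> w" "(1 + w)\<^sup>2 \<le> x"
    and "0 < r" "r \<le> x - y\<^sup>2 / 4" "0 \<le> c" "1 \<le> 4 * c\<^sup>2 * (r * w\<^sup>2)"
  shows "\<bar>a i - centre x y\<bar> \<le> c"
proof (rule cycle_bound_elliptic_le[OF assms(1-3)])
  have "r * w\<^sup>2 \<le> (x - y\<^sup>2 / 4) * (sqrt x - 1)\<^sup>2"
    using assms(6,7) by (intro mult_mono sqrt_diff_one_ge[OF assms(4,5)]) auto
  then have "4 * c\<^sup>2 * (r * w\<^sup>2) \<le> 4 * c\<^sup>2 * ((x - y\<^sup>2 / 4) * (sqrt x - 1)\<^sup>2)"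
    by (intro mult_left_mono) auto
  then show "1 \<le> 4 * c\<^sup>2 * ((x - y\<^sup>2 / 4) * (sqrt x - 1)\<^sup>2)" using assms(9) by linarith
qed (use assms in auto)

lemma centre_bounds:
  assumes "0 \<le> k" "k \<le> x + y"
  shows "0 \<le> centre x y" "centre x y \<le> 1 / (2 * (1 + k))"
  using assms by (auto simp: centre_def intro!: divide_left_mono)

lemma cycle_bound_near_line:
  assumes cyc: "srs_cycle x y a" and x: "4 / 3 \<le> x" and y: "y < x + 1" "x + 1 < y + 1 / 11"
  shows "(x + 1 - y) * \<bar>a i\<bar> \<le> 4 * (x - 1)"
proof -
  define g where "g = \<bar>a i - centre x y\<bar>"
  define u where "u = sqrt x"
  define w where "w = u - 1"
  define z where "z = w\<^sup>2"
  \<comment> \<open>In these variables \<open>\<delta> = z + 2 m\<close> and \<open>x - y\<^sup>2 / 4 = m (2 u - m)\<close>.\<close>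
  define m where "m = u - y / 2"
  define d where "d = x + 1 - y"
  have d: "0 < d" "d < 1 / 11" using y by (auto simp: d_def)
  \<comment> \<open>\<open>y > 2\<close> and \<open>x \<ge> 4/3\<close> give
    \<open>x + y \<ge> 10/3\<close>, and the centre is at most \<open>3/26 < 0.1154\<close>.\<close>
  have h: "0 \<le> centre x y" "centre x y \<le> 1154 / 10000"
    using centre_bounds[of "10 / 3" x y] x y by auto
  have "d * \<bar>a i\<bar> \<le> d * (g + 1154 / 10000)"
    using h d by (intro mult_left_mono) (auto simp: g_def)
  also have "\<dots> \<le> g * d + 105 / 10000" using d by (simp add: algebra_simps)
  finally have le: "d * \<bar>a i\<bar> \<le> g * d + 105 / 10000" .
  have u2: "u\<^sup>2 = x" using x by (simp add: u_def)
  \<comment> \<open>A rational number just below the square root of \<open>4/3\<close>.\<close>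
  have "1.1547 \<le> u" unfolding u_def using x by (intro real_le_rsqrt) (simp add: power2_eq_square)
  then have w: "0.1547 \<le> w" by (simp add: w_def)
  have "0.1547\<^sup>2 \<le> w\<^sup>2" using w by (intro power_mono) auto
  then have z: "0.02393 \<le> z" by (simp add: z_def power2_eq_square)
  have x1: "x - 1 = w * (u + 1)" using u2 by (simp add: w_def power2_eq_square algebra_simps)
  have dm: "d = z + 2 * m"
    using u2 by (simp add: d_def z_def w_def m_def power2_eq_square algebra_simps)
  show ?thesis
  proof (cases "x - y\<^sup>2 / 4 \<le> d / 4")
    case True
    then have "g * d \<le> 1"
      using cycle_bound_hyperbolic[OF cyc, of i] x y by (simp add: g_def d_def)
    then show ?thesis using le x by (simp add: d_def)
  next
    case False
    define r where "r = x - y\<^sup>2 / 4"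
    have r: "d / 4 < r" using False by (simp add: r_def)
    have rm: "r = m * (2 * u - m)"
      using u2 by (simp add: r_def m_def power2_eq_square algebra_simps)
    \<comment> \<open>If \<open>0 \<le> m\<close>, then \<open>z \<le> d < 1/11\<close>, and
      \<open>0.3016\<close> slightly exceeds the square root of \<open>1/11\<close>.\<close>
    have "w\<^sup>2 < 0.3016\<^sup>2 \<or> m < 0"
      using dm d by (auto simp: z_def power2_eq_square)
    moreover have m0: "0 < m"
    proof -
      have "0 < m * (2 * u - m)" using r d rm by linarith
      moreover have "0 < 2 * u - m" using \<open>1.1547 \<le> u\<close> x y by (simp add: m_def)
      ultimately show ?thesis by (simp add: zero_less_mult_iff)
    qed
    ultimately have "w < 0.3016" using w power_less_imp_less_base[of w 2 "0.3016"] by simp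
    then have u': "u < 1.3016" by (simp add: w_def)
    \<comment> \<open>It remains to see \<open>\<delta>\<^sup>2 \<le> 289 z\<^sup>2 r\<close>, which reduces to a quadratic inequality in \<open>m\<close> on this interval.\<close>
    have m1: "m < 0.0336" using dm d z by simp
    \<comment> \<open>Combining \<open>(z + 2 * m) / 4 < r \<le> 2.6032 * m\<close> with the lower
      bound on \<open>z\<close> keeps \<open>m\<close> away from 0.\<close>
    have m2: "0.0028 < m"
    proof (rule ccontr)
      assume "\<not> 0.0028 < m"
      have "m * (2 * u - m) \<le> m * 2.6032" using u' m0 by (intro mult_left_mono) auto
      then show False using r rm dm z \<open>\<not> 0.0028 < m\<close> by simp
    qed
    have "m * 2.275 \<le> r" unfolding rm using m0 m1 \<open>1.1547 \<le> u\<close> by (intro mult_left_mono) auto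
    moreover have "d \<le> z * (1 + 83.6 * m)"
    proof -
      have "2.0005 * m \<le> (z * 83.6) * m" using z m0 by (intro mult_right_mono) auto
      then show ?thesis using dm m0 by (simp add: algebra_simps)
    qed
    then have "d\<^sup>2 \<le> (z * (1 + 83.6 * m))\<^sup>2" using d by (intro power_mono) auto
    moreover have "(1 + 83.6 * m)\<^sup>2 \<le> 657 * m"
    proof -
      have "0 \<le> (m - 0.0028) * (0.0336 - m)" using m1 m2 by (intro mult_nonneg_nonneg) auto
      then show ?thesis using m2 by (simp add: power2_eq_square algebra_simps)
    qed
    then have "z\<^sup>2 * (1 + 83.6 * m)\<^sup>2 \<le> z\<^sup>2 * (657 * m)" by (intro mult_left_mono) auto
    moreover have "z\<^sup>2 * (657 * m) \<le> z\<^sup>2 * (289 * r)"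
      using \<open>m * 2.275 \<le> r\<close> m0 by (intro mult_left_mono) auto
    ultimately have dr: "d\<^sup>2 \<le> z\<^sup>2 * (289 * r)" by (simp only: power_mult_distrib order_trans)
    \<comment> \<open>\<open>289 = 4 * 8.5\<^sup>2\<close>. The value 8.5 stays below
      \<open>4 * (u + 1) \<ge> 8.6188\<close>, and the gap absorbs the contribution of the
      centre.\<close>
    have "g \<le> 8.5 * w / d"
      unfolding g_def
    proof (rule cycle_bound_elliptic_le[OF cyc])
      have "4 * (8.5 * w / d)\<^sup>2 * (r * z) = z\<^sup>2 * (289 * r) / d\<^sup>2"
        by (simp add: z_def power2_eq_square)
      also have "1 \<le> \<dots>" using dr d by (simp add: le_divide_eq)
      finally show "1 \<le> 4 * (8.5 * w / d)\<^sup>2 * ((x - y\<^sup>2 / 4) * (sqrt x - 1)\<^sup>2)"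
        by (simp only: r_def z_def w_def u_def)
    qed (use x y r d w in \<open>auto simp: r_def\<close>)
    then have "g * d \<le> 8.5 * w" using d by (simp add: field_simps)
    moreover have "8.6188 * w \<le> 4 * (x - 1)"
      unfolding x1 using w \<open>1.1547 \<le> u\<close> mult_right_mono[of "8.6188" "4 * (u + 1)" w] by (simp add: algebra_simps)
    ultimately have "g * d + 105 / 10000 \<le> 4 * (x - 1)" using w by simp
    then show ?thesis using le by (simp add: d_def)
  qed
qed

lemma abs_int_less:
  fixes c g :: real
  shows "\<bar>of_int n - c\<bar> \<le> g \<Longrightarrow> 0 \<le> c \<Longrightarrow> g + c < of_int k \<Longrightarrow> \<bar>n\<bar> < k"
  by linarith

lemma cycle_bound_13:
  assumes cyc: "srs_cycle x y a" and x: "4 / 3 \<le> x" and y: "2 < y" "y + 1 / 11 \<le> x + 1" "x + 1 < y + 8 / 25"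
  shows "\<bar>a i\<bar> < 13"
proof -
  define g where "g = \<bar>a i - centre x y\<bar>"
  define u where "u = sqrt x"
  define z where "z = (u - 1)\<^sup>2"
  define m where "m = u - y / 2"
  define r where "r = x - y\<^sup>2 / 4"
  have h: "0 \<le> centre x y" "centre x y \<le> 1154 / 10000"
    using centre_bounds[of "10 / 3" x y] x y by auto
  have u2: "u\<^sup>2 = x" using x by (simp add: u_def)
  have u: "1.1547 \<le> u" unfolding u_def using x by (intro real_le_rsqrt) (simp add: power2_eq_square)
  then have "0.1547\<^sup>2 \<le> (u - 1)\<^sup>2" by (intro power_mono) auto
  then have z: "0.02393 \<le> z" by (simp add: z_def power2_eq_square)
  have dm: "x + 1 - y = z + 2 * m"
    using u2 by (simp add: z_def m_def power2_eq_square algebra_simps)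
  have rm: "r = m * (2 * u - m)"
    using u2 by (simp add: r_def m_def power2_eq_square algebra_simps)
  \<comment> \<open>Adding the centre, at most \<open>0.1154\<close>, keeps the sum below
    13.\<close>
  have "g \<le> 12.88"
  proof (cases "r \<le> (x + 1 - y) / 4")
    case True
    then have "g * (x + 1 - y) \<le> 1"
      using cycle_bound_hyperbolic[OF cyc, of i] y by (simp add: g_def r_def)
    moreover have "g * (1 / 11) \<le> g * (x + 1 - y)" using y by (intro mult_left_mono) (auto simp: g_def)
    ultimately show ?thesis by simp
  next
    case False
    then have r: "1 / 44 < r" using y by simp
    have sum: "2.15 \<le> 2 * u - m" using u y by (simp add: m_def)
    have m0: "0 < m"
    proof -
      have "0 < m * (2 * u - m)" using r rm by linarith
      then show ?thesis using sum by (simp add: zero_less_mult_iff)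
    qed
    \<comment> \<open>As \<open>z + 2 * m \<ge> 1/11\<close>, the numbers \<open>z\<close> and
      \<open>m\<close> are not both small. For large \<open>m\<close> the universal bound on
      \<open>z\<close> suffices, and for small \<open>m\<close> the bound
      \<open>r > 1/44\<close>.\<close>
    have rz: "0.00151 \<le> r * z"
    proof (cases "1 / 30 \<le> m")
      case True
      then have "1 / 30 * 2.15 \<le> r" unfolding rm using sum by (intro mult_mono) auto
      then have "1 / 30 * 2.15 * 0.02393 \<le> r * z" using z by (intro mult_mono) auto
      then show ?thesis by simp
    next
      case m: False
      have zm: "1 / 11 - 2 * m \<le> z" using dm y by simp
      have rm': "m * 2.276 \<le> r" unfolding rm using m0 m u by (intro mult_left_mono) auto
      show ?thesis
      proof (cases "0.01 \<le> m")
        case True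
        \<comment> \<open>On this interval the concave function \<open>m * (1 / 11 - 2 * m)\<close>
          is bounded below by its secant.\<close>
        have "0 \<le> (m - 0.01) * (1 / 30 - m)" using True m by (intro mult_nonneg_nonneg) auto
        then have "m * m \<le> 13 / 300 * m - 1 / 3000" by (simp add: field_simps)
        moreover have "m * (1 / 11 - 2 * m) = m / 11 - 2 * (m * m)" by (simp add: algebra_simps)
        ultimately have "0.000709 \<le> m * (1 / 11 - 2 * m)" using True by simp
        then have "0.00151 \<le> (m * 2.276) * (1 / 11 - 2 * m)" by simp
        also have "\<dots> \<le> r * z" using rm' zm m0 m r by (intro mult_mono) auto
        finally show ?thesis .
      next
        case False
        then have "1 / 44 * 0.0709 \<le> r * z" using r zm by (intro mult_mono) auto
        then show ?thesis by simp
      qed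
    qed
    show ?thesis unfolding g_def
    proof (rule cycle_bound_elliptic_le[OF cyc])
      have "1 \<le> 4 * 12.88\<^sup>2 * (r * z)" using rz by (simp add: power2_eq_square)
      then show "1 \<le> 4 * 12.88\<^sup>2 * ((x - y\<^sup>2 / 4) * (sqrt x - 1)\<^sup>2)"
        by (simp only: r_def z_def u_def)
    qed (use x y r in \<open>auto simp: r_def\<close>)
  qed
  then show ?thesis using abs_int_less[of "a i" "centre x y" "12.88" 13] h by (simp add: g_def)
qed

text \<open>Used in contrapositive form: an entry of absolute value at least 6 forces
  \<open>x + 1 - y < 8/25\<close>, a further wall for the search. In each range of \<open>y\<close>
  the bound on \<open>g\<close> plus that on the centre stays just below 6.\<close>

lemma cycle_bound_6:
  assumes cyc: "srs_cycle x y a" and x: "4 / 3 \<le> x" "x \<le> 3" and y: "0 \<le> x + y" "y + 8 / 25 \<le> x + 1"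
  shows "\<bar>a i\<bar> < 6"
proof -
  note product = cycle_bound_elliptic_product[OF cyc, of _ _ _ i]
  define g where "g = \<bar>a i - centre x y\<bar>"
  have h: "0 \<le> centre x y" "centre x y \<le> 1 / 2"
    using centre_bounds[of 0 x y] y by auto
  consider "2 < y" | "- 1 \<le> y" "y \<le> 2" | "y < - 1" by linarith
  then show ?thesis
  proof cases
    case 1
    have h': "centre x y \<le> 1154 / 10000"
      using centre_bounds[of "10 / 3" x y] x 1 by auto
    have "g \<le> 5.88"
    proof (cases "x - y\<^sup>2 / 4 \<le> (x + 1 - y) / 4")
      case True
      then have "g * (x + 1 - y) \<le> 1"
        using cycle_bound_hyperbolic[OF cyc, of i] y 1 by (simp add: g_def)
      moreover have "g * (8 / 25) \<le> g * (x + 1 - y)" using y by (intro mult_left_mono) (auto simp: g_def)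
      ultimately show ?thesis by simp
    next
      case False
      \<comment> \<open>The resulting lower bound for \<open>x - y\<^sup>2 / 4\<close> is concave in
        \<open>x\<close>, hence controlled by interval endpoints. It decreases over the first two
        intervals, while the available \<open>w\<close> below \<open>sqrt x - 1\<close> grows.
        Beyond 1.7 the bound \<open>(x + 1 - y) / 4 \<ge> 0.08\<close> is enough.\<close>
      have "y\<^sup>2 \<le> (x + 0.68)\<^sup>2" using y 1 by (intro power_mono) auto
      then have r: "x - (x + 0.68)\<^sup>2 / 4 \<le> x - y\<^sup>2 / 4" by simp
      consider "x \<le> 1.5" | "1.5 < x" "x \<le> 1.7" | "1.7 < x" by linarith
      then show ?thesis
      proof cases
        case a: 1
        have "0 \<le> (x - 4 / 3) * (1.5 - x)" using a x by (intro mult_nonneg_nonneg) auto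
        then have "0.3118 \<le> x - (x + 0.68)\<^sup>2 / 4" using a x by (simp add: power2_eq_square field_simps)
        then have "0.3118 \<le> x - y\<^sup>2 / 4" using r by linarith
        then show ?thesis unfolding g_def using x y
          by (intro product[of "0.1547" "0.3118"]) (auto simp: power2_eq_square)
      next
        case a: 2
        have "0 \<le> (x - 1.5) * (1.7 - x)" using a by (intro mult_nonneg_nonneg) auto
        then have "0.28 \<le> x - (x + 0.68)\<^sup>2 / 4" using a by (simp add: power2_eq_square field_simps)
        then have "0.28 \<le> x - y\<^sup>2 / 4" using r by linarith
        then show ?thesis unfolding g_def using x y a
          by (intro product[of "0.2247" "0.28"]) (auto simp: power2_eq_square)
      next
        case a: 3
        then show ?thesis unfolding g_def using x y False
          by (intro product[of "0.3038" "0.08"]) (auto simp: power2_eq_square)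
      qed
    qed
    then show ?thesis using abs_int_less[of "a i" "centre x y" "5.88" 6] h h' by (simp add: g_def)
  next
    case 2
    have h': "centre x y \<le> 3 / 8"
      using centre_bounds[of "1 / 3" x y] x 2 by auto
    have "y\<^sup>2 \<le> 2\<^sup>2" using 2 by (intro abs_le_square_iff[THEN iffD1]) auto
    then have "g \<le> 5.62" unfolding g_def using x y
      by (intro product[of "0.1547" "1 / 3"]) (auto simp: power2_eq_square)
    then show ?thesis using abs_int_less[of "a i" "centre x y" "5.62" 6] h h' by (simp add: g_def)
  next
    case 3
    have "y\<^sup>2 \<le> x\<^sup>2" using 3 y x by (intro abs_le_square_iff[THEN iffD1]) auto
    moreover have "0 \<le> (x - 1) * (3 - x)" using x by (intro mult_nonneg_nonneg) auto
    ultimately have "3 / 4 \<le> x - y\<^sup>2 / 4" by (simp add: power2_eq_square algebra_simps)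
    then have "g \<le> 5.4" unfolding g_def using x y
      by (intro product[of "0.1547" "3 / 4"]) (auto simp: power2_eq_square)
    then show ?thesis using abs_int_less[of "a i" "centre x y" "5.4" 6] h by (simp add: g_def)
  qed
qed

lemma cycle_bound_4:
  assumes cyc: "srs_cycle x y a" and x: "4 / 3 \<le> x" "x \<le> 3" and y: "0 \<le> x + y" "y + 3 / 4 \<le> x + 1"
  shows "\<bar>a i\<bar> < 4"
proof -
  note product = cycle_bound_elliptic_product[OF cyc, of _ _ _ i]
  define g where "g = \<bar>a i - centre x y\<bar>"
  have h: "0 \<le> centre x y" "centre x y \<le> 1 / 2"
    using centre_bounds[of 0 x y] y by auto
  consider "2 < y" | "1 \<le> y" "y \<le> 2" | "- 1 \<le> y" "y < 1" | "y < - 1" by linarith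
  then show ?thesis
  proof cases
    case 1
    have h': "centre x y \<le> 1154 / 10000"
      using centre_bounds[of "10 / 3" x y] x 1 by auto
    have "g \<le> 3.88"
    proof (cases "x - y\<^sup>2 / 4 \<le> (x + 1 - y) / 4")
      case True
      then have "g * (x + 1 - y) \<le> 1"
        using cycle_bound_hyperbolic[OF cyc, of i] y 1 by (simp add: g_def)
      moreover have "g * (3 / 4) \<le> g * (x + 1 - y)" using y by (intro mult_left_mono) (auto simp: g_def)
      ultimately show ?thesis by simp
    next
      case False
      \<comment> \<open>From \<open>y > 2\<close> follows \<open>x > 1.75\<close>, which permits
        \<open>w = 0.3228\<close>; and \<open>3/16\<close> is a quarter of
        \<open>3/4\<close>.\<close>
      then show ?thesis unfolding g_def using x y 1
        by (intro product[of "0.3228" "3 / 16"]) (auto simp: power2_eq_square)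
    qed
    then show ?thesis using abs_int_less[of "a i" "centre x y" "3.88" 4] h h' by (simp add: g_def)
  next
    case 2
    have h': "centre x y \<le> 15 / 100"
      using centre_bounds[of "7 / 3" x y] x 2 by auto
    \<comment> \<open>The bounds \<open>y \<le> x + 1/4\<close> and \<open>y \<le> 2\<close>
      coincide at \<open>x = 1.75\<close>.\<close>
    have "0.7065 \<le> x - y\<^sup>2 / 4"
    proof (cases "x \<le> 1.75")
      case True
      have "y\<^sup>2 \<le> (x + 1 / 4)\<^sup>2" using y 2 by (intro power_mono) auto
      moreover have "0 \<le> (x - 4 / 3) * (1.75 - x)" using True x by (intro mult_nonneg_nonneg) auto
      then have "0.7065 \<le> x - (x + 1 / 4)\<^sup>2 / 4" using True x by (simp add: power2_eq_square field_simps)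
      ultimately show ?thesis by simp
    next
      case False
      have "y\<^sup>2 \<le> 2\<^sup>2" using 2 by (intro power_mono) auto
      then show ?thesis using False by simp
    qed
    then have "g \<le> 3.849" unfolding g_def using x y
      by (intro product[of "0.1547" "0.7065"]) (auto simp: power2_eq_square)
    then show ?thesis using abs_int_less[of "a i" "centre x y" "3.849" 4] h h' by (simp add: g_def)
  next
    case 3
    have h': "centre x y \<le> 3 / 8"
      using centre_bounds[of "1 / 3" x y] x 3 by auto
    have "y\<^sup>2 \<le> 1\<^sup>2" using 3 by (intro abs_le_square_iff[THEN iffD1]) auto
    then have "g \<le> 3.6" unfolding g_def using x y
      by (intro product[of "0.1547" "1"]) (auto simp: power2_eq_square)
    then show ?thesis using abs_int_less[of "a i" "centre x y" "3.6" 4] h h' by (simp add: g_def)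
  next
    case 4
    have "y\<^sup>2 \<le> x\<^sup>2" using 4 y x by (intro abs_le_square_iff[THEN iffD1]) auto
    then have r: "x - x\<^sup>2 / 4 \<le> x - y\<^sup>2 / 4" by simp
    have "g \<le> 3.49"
    proof (cases "x \<le> 2.5")
      case True
      have "0 \<le> (x - 4 / 3) * (2.5 - x)" using True x by (intro mult_nonneg_nonneg) auto
      then have "8 / 9 \<le> x - x\<^sup>2 / 4" using True x by (simp add: power2_eq_square field_simps)
      then show ?thesis unfolding g_def using x y r
        by (intro product[of "0.1547" "8 / 9"]) (auto simp: power2_eq_square)
    next
      case False
      have "0 \<le> (x - 1) * (3 - x)" using x by (intro mult_nonneg_nonneg) auto
      then have "3 / 4 \<le> x - x\<^sup>2 / 4" by (simp add: power2_eq_square algebra_simps)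
      then show ?thesis unfolding g_def using x y r False
        by (intro product[of "0.5" "3 / 4"]) (auto simp: power2_eq_square)
    qed
    then show ?thesis using abs_int_less[of "a i" "centre x y" "3.49" 4] h by (simp add: g_def)
  qed
qed

section \<open>Vanishing of cycles\<close>

lemma check_roots_all:
  assumes "1 \<le> K" "K \<le> 12" "\<bar>s\<bar> = K"
  shows "\<exists>ts. check_roots K (walls K) s ts"
proof -
  have "K \<in> {1, 2, 3, 4, 5, 6, 7, 8, 9, 10, 11, 12}" using assms by (simp; presburger)
  moreover have "s = K \<or> s = - K" using assms by linarith
  ultimately show ?thesis
    using check_roots_1 check_roots_2 check_roots_3 check_roots_4 check_roots_5 check_roots_6
      check_roots_7 check_roots_8 check_roots_9 check_roots_10 check_roots_11 check_roots_12
    by (elim insertE disjE emptyE) (hypsubst, erule exI, assumption?)+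
qed

lemma cycle_zero:
  assumes cyc: "srs_cycle x y a" and x: "4 / 3 \<le> x" "x \<le> 3" and y: "0 \<le> x + y" "y < x + 1"
  shows "a i = 0"
proof (cases "x + 1 < y + 1 / 11")
  case True
  show ?thesis
    using cycle_zero_near_line[OF cyc x(1) y(2) True] cycle_bound_near_line[OF cyc x(1) y(2) True] .
next
  case False
  obtain p where p: "0 < p" "\<And>i. a (i + p) = a i" using cyc by (auto simp: srs_cycle_def)
  obtain k where k: "\<And>i. \<bar>a i\<bar> \<le> \<bar>a k\<bar>"
    using periodic_attains_max[of p "\<lambda>i. \<bar>a i\<bar>"] p by auto
  define K where "K = \<bar>a k\<bar>"
  have K4: "x + 1 < y + 3 / 4" if "4 \<le> K"
    using cycle_bound_4[OF cyc x y(1), of k] that by (fastforce simp: K_def)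
  have K6: "x + 1 < y + 8 / 25" if "6 \<le> K"
    using cycle_bound_6[OF cyc x y(1), of k] that by (fastforce simp: K_def)
  have K13: "K \<le> 12"
  proof (cases "y + 8 / 25 \<le> x + 1")
    case True
    then show ?thesis using K6 by linarith
  next
    \<comment> \<open>Here \<open>y > x + 1 - 8/25 > 2\<close>, as \<open>cycle_bound_13\<close>
      requires.\<close>
    case far: False
    then show ?thesis
      using cycle_bound_13[OF cyc x(1), of k] False x by (simp add: K_def)
  qed
  show ?thesis
  proof (rule ccontr)
    assume "a i \<noteq> 0"
    then have "1 \<le> K" using k[of i] by (simp add: K_def)
    then obtain ts where "check_roots K (walls K) (a k) ts"
      using check_roots_all K13 K_def by blast
    moreover have "list_all (holds x y) (walls K)"
      using x y False K4 K6 by (simp add: walls_def) linarith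
    ultimately show False
      using check_roots_sound[of K "walls K" "a k" ts x y a k] cyc x k by (auto simp: K_def)
  qed
qed

section \<open>From ultimately periodic orbits to integer-indexed cycles, and the shape of the
  region\<close>

lemma ultimately_periodic_orbit_cycle:
  assumes p: "0 < p" "\<And>n. n0 \<le> n \<Longrightarrow> srs_orbit (x, y) v (n + p) = srs_orbit (x, y) v n"
  defines "a \<equiv> \<lambda>i. srs_orbit (x, y) v (n0 + nat (i mod int p))"
  shows "srs_cycle x y a" "srs_orbit (x, y) v (n0 + m) = a (int m)"
proof -
  define s where "s = srs_orbit (x, y) v"
  have add: "s (n0 + m + k * p) = s (n0 + m)" for m k
    using p(2)[of "n0 + m + _ * p"] by (induction k) (simp_all add: s_def ac_simps)
  have mod: "s (n0 + m) = s (n0 + m mod p)" for m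
    using add[of "m mod p" "m div p"] by (simp add: add.assoc)
  then show "srs_orbit (x, y) v (n0 + m) = a (int m)" for m
    by (simp add: a_def s_def[symmetric] nat_mod_distrib)
  \<comment> \<open>The residues of \<open>i\<close>, \<open>i + 1\<close>, \<open>i + 2\<close> may
    wrap around the period. Walking on from the position of \<open>i\<close> instead makes them
    consecutive positions of the orbit, where its recursion applies.\<close>
  then have shift: "a (i + int k) = s (n0 + nat (i mod int p) + k)" for i k
  proof -
    have "a (i + int k) = a (int (nat (i mod int p) + k))"
      using p(1) by (simp add: a_def mod_simps)
    then show ?thesis
      using \<open>\<And>m. srs_orbit (x, y) v (n0 + m) = a (int m)\<close>[of "nat (i mod int p) + k"]
      by (simp add: s_def add.assoc)
  qed
  show "srs_cycle x y a" unfolding srs_cycle_def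
  proof (intro conjI allI)
    show "\<exists>p>0. \<forall>i. a (i + p) = a i" using p(1) by (intro exI[of _ "int p"]) (simp add: a_def)
    fix i
    define n where "n = n0 + nat (i mod int p)"
    have a: "a i = s n" "a (i + 1) = s (n + 1)" "a (i + 2) = s (n + 2)"
      using shift[of i 0] shift[of i 1] shift[of i 2] by (simp_all add: n_def)
    have "s (n + 2) = - \<lfloor>x * s n + y * s (n + 1)\<rfloor>" by (simp only: s_def srs_orbit_rec fst_conv snd_conv)
    then show "0 \<le> x * a i + y * a (i + 1) + a (i + 2)" "x * a i + y * a (i + 1) + a (i + 2) < 1"
      unfolding a by linarith+
  qed
qed

text \<open>If \<open>x > 3\<close>, then \<open>x > 3/2 + sqrt 2\<close>, and the second-to-last
  excluded set forces \<open>y \<ge> x + 1/2\<close>. This implies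
  \<open>y\<^sup>2 \<ge> 4 * x\<close> and \<open>y > 7/2 > 1 + sqrt 5\<close>, so the point falls
  into the last excluded set.\<close>

lemma region_R_bounds:
  assumes "(x, y) \<in> region_R" "4 / 3 \<le> x"
  shows "x \<le> 3" "0 \<le> x + y" "y < x + 1"
proof -
  have R: "\<not> (- 2 < x + y \<and> x + y < 0)" "y \<noteq> x + 1" "\<not> (y \<le> - 2 * sqrt x \<and> 0 \<le> x + y)"
      "\<not> (x + y \<le> - 2 \<and> x - y \<noteq> - 1 \<and> \<not> - 1 < y)" "\<not> x - y < - 1"
      "\<not> (- 1 / 2 < x - y \<and> max (- 2 * sqrt x) (- x) \<le> y \<and> 3 / 2 + sqrt 2 < x)"
      "\<not> (- 1 < x - y \<and> x - y \<le> - 1 / 2 \<and> 1 + sqrt 5 \<le> y \<and> 4 * x \<le> y\<^sup>2)"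
    using assms unfolding region_R_def by auto
  show sum: "0 \<le> x + y" using R(1,4) assms(2) by linarith
  show less: "y < x + 1" using R(2,5) by linarith
  show "x \<le> 3"
  proof (rule ccontr)
    assume "\<not> x \<le> 3"
    then have x: "3 < x" by simp
    have "sqrt 2 < 3 / 2" by (rule real_less_lsqrt) (simp_all add: power2_eq_square)
    then have y: "x + 1 / 2 \<le> y" using R(3,6) sum x by (auto simp: max_def split: if_splits)
    have "0 \<le> (x - 3) * x" using x by simp
    then have "4 * x \<le> (x + 1 / 2)\<^sup>2" by (simp add: power2_eq_square algebra_simps)
    also have "\<dots> \<le> y\<^sup>2" using x y by (intro power_mono) auto
    finally have "4 * x \<le> y\<^sup>2" .
    moreover have "sqrt 5 < 5 / 2" by (rule real_less_lsqrt) (simp_all add: power2_eq_square)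
    ultimately show False using R(7) y less x by auto
  qed
qed

theorem theorem7:
  shows "region_R \<inter> {(x, y). x \<ge> 4/3} \<subset> D2star"
proof
  show "region_R \<inter> {(x, y). x \<ge> 4/3} \<subseteq> D2star"
  proof clarify
    fix x y :: real
    assume "(x, y) \<in> region_R" and x: "4 / 3 \<le> x"
    note bounds = region_R_bounds[OF this]
    have "ends_in_trivial_cycle (srs_orbit (x, y) v)"
      if per: "ultimately_periodic (srs_orbit (x, y) v)" for v
    proof -
      obtain n0 p where p: "0 < p" "\<And>n. n0 \<le> n \<Longrightarrow> srs_orbit (x, y) v (n + p) = srs_orbit (x, y) v n"
        using per by (auto simp: ultimately_periodic_def)
      note cycle = ultimately_periodic_orbit_cycle[of p n0 x y v, OF p]
      have "srs_orbit (x, y) v (n0 + m) = 0" for m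
        using cycle(2) cycle_zero[OF cycle(1) x bounds] by simp
      then show ?thesis unfolding ends_in_trivial_cycle_def by (metis le_iff_add)
    qed
    then show "(x, y) \<in> D2star" by (simp add: D2star_def)
  qed
  \<comment> \<open>Strictness of the inclusion is witnessed by \<open>(0, 0)\<close>, for which
    every orbit vanishes from index 2 on.\<close>
  have "srs_orbit (0, 0) v n = 0" if "2 \<le> n" for v n
    using srs_orbit_rec[of "(0, 0)" v "n - 2"] le_add_diff_inverse2[OF that] by simp
  then have "(0, 0) \<in> D2star" by (auto simp: D2star_def ends_in_trivial_cycle_def)
  moreover have "(0, 0) \<notin> {(x, y). (x :: real) \<ge> 4/3}" by simp
  ultimately show "region_R \<inter> {(x, y). x \<ge> 4/3} \<noteq> D2star" by blast
qed

end
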